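(* Let $k\ge 3$ and let $n, c$ be positive integers with $n^2-n+1 < c \le n^2$. Then $\Delta(\langle c\rangle_k) \not\subseteq \Delta(\mathsf{M}_n^k)$.
   Context: For a nonzero tensor $T \in \mathbb{C}^{n_1}\otimes\cdots\otimes\mathbb{C}^{n_k}$, let $T_i$ be its $i$-th flattening $\mathbb{C}^{n_i}\to\bigotimes_{j\ne i}\mathbb{C}^{n_j}$ and $\mu_i(T) = T_i^*T_i/\|T\|^2$; let $\mathrm{spec}$ of a positive semidefinite matrix be its eigenvalue vector in non-increasing order, and $\mathrm{spec}(\mu(T)) = (\mathrm{spec}(\mu_1(T))\mid\cdots\mid\mathrm{spec}(\mu_k(T)))$. With $\mathrm{GL}=\mathrm{GL}_{n_1}\times\cdots\times\mathrm{GL}_{n_k}$ acting by local basis changes, the moment polytope is $\Delta(T) = \{\mathrm{spec}(\mu(S)) : S\in\overline{\mathrm{GL}\cdot T}\setminus\{0\}\}$. Polytopes of tensors in different spaces are compared after padding each component with zeros. The order-$k$ unit tensor is $\langle r\rangle_k = \sum_{j=1}^r e_j^{\otimes k}\in(\mathbb{C}^r)^{\otimes k}$, and the iterated matrix multiplication tensor is $\mathsf{M}_n^k = \sum_{i\in[n]^k}\bigotimes_{\ell=1}^k e_{i_\ell,i_{\ell+1}} \in (\mathbb{C}^{n^2})^{\otimes k}$ with $i_{k+1}=i_1$, where $e_{i,j}$ are the standard basis vectors of $\mathbb{C}^{n^2}=\mathbb{C}^{n\times n}$. *)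

theory Defs
  imports
    "HOL-Analysis.Function_Topology"
    "Jordan_Normal_Form.Schur_Decomposition"
begin

text \<open>
  A tensor in the space with dimensions \<open>ns = [n\<^sub>1, \<dots>, n\<^sub>k]\<close> is given by its coordinates, as a
  function on multi-indices that vanishes outside \<open>multi_indices ns\<close>.  All indices are 0-based.
  The function type carries the product topology, which induces the Euclidean topology on each
  of these (closed, finite-dimensional) tensor spaces.
\<close>

type_synonym tensor = "nat list \<Rightarrow> complex"

definition multi_indices :: "nat list \<Rightarrow> nat list list" where
  "multi_indices ns = product_lists (map (\<lambda>n. [0..<n]) ns)"

definition tensor_product :: "complex vec list \<Rightarrow> tensor" where
  "tensor_product vs = (\<lambda>js. if js \<in> set (multi_indices (map dim_vec vs))
     then \<Prod>l<length vs. (vs ! l) $ (js ! l) else 0)"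

definition tensor_norm :: "nat list \<Rightarrow> tensor \<Rightarrow> real" where
  "tensor_norm ns T = sqrt (\<Sum>js\<in>set (multi_indices ns). (cmod (T js))\<^sup>2)"

text \<open>
  The rows of the matrix of the \<open>i\<close>-th flattening are indexed by the positions in the list of
  multi-indices of the remaining factors.
\<close>

definition flattening :: "nat list \<Rightarrow> nat \<Rightarrow> tensor \<Rightarrow> complex mat" where
  "flattening ns i T =
     (let rs = multi_indices (take i ns @ drop (Suc i) ns)
      in mat (length rs) (ns ! i) (\<lambda>(r, a). T (take i (rs ! r) @ a # drop i (rs ! r))))"

definition moment_component :: "nat list \<Rightarrow> nat \<Rightarrow> tensor \<Rightarrow> complex mat" where
  "moment_component ns i T =
     complex_of_real (1 / (tensor_norm ns T)\<^sup>2) \<cdot>\<^sub>m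
       (mat_adjoint (flattening ns i T) * flattening ns i T)"

definition spec :: "complex mat \<Rightarrow> real list" where
  "spec A = (THE xs. sorted_wrt (\<ge>) xs \<and> char_poly A = (\<Prod>x\<leftarrow>xs. [:- complex_of_real x, 1:]))"

definition spec_moment :: "nat list \<Rightarrow> tensor \<Rightarrow> real list list" where
  "spec_moment ns T = map (\<lambda>i. spec (moment_component ns i T)) [0..<length ns]"

definition GL_product :: "nat list \<Rightarrow> complex mat list set" where
  "GL_product ns = {gs. length gs = length ns \<and>
     (\<forall>i<length ns. gs ! i \<in> carrier_mat (ns ! i) (ns ! i) \<and> invertible_mat (gs ! i))}"

definition local_action :: "nat list \<Rightarrow> complex mat list \<Rightarrow> tensor \<Rightarrow> tensor" where
  "local_action ns gs T = (\<lambda>is. if is \<in> set (multi_indices ns)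
     then \<Sum>js\<in>set (multi_indices ns). (\<Prod>l<length ns. (gs ! l) $$ (is ! l, js ! l)) * T js
     else 0)"

definition GL_orbit :: "nat list \<Rightarrow> tensor \<Rightarrow> tensor set" where
  "GL_orbit ns T = (\<lambda>gs. local_action ns gs T) ` GL_product ns"

definition moment_polytope :: "nat list \<Rightarrow> tensor \<Rightarrow> real list list set" where
  "moment_polytope ns T = spec_moment ns ` (closure (GL_orbit ns T) - {\<lambda>_. 0})"

definition pad_components :: "nat \<Rightarrow> real list list \<Rightarrow> real list list" where
  "pad_components m p = map (\<lambda>x. x @ replicate (m - length x) 0) p"

definition unit_tensor :: "nat \<Rightarrow> nat \<Rightarrow> tensor" where
  "unit_tensor k r = (\<lambda>js. \<Sum>j<r. tensor_product (replicate k (unit_vec r j)) js)"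

text \<open>The basis vector \<open>e\<^bsub>i,j\<^esub>\<close> of \<open>n \<times> n\<close> matrices is identified with the basis vector number \<open>i * n + j\<close>.\<close>

definition matrix_unit_vec :: "nat \<Rightarrow> nat \<Rightarrow> nat \<Rightarrow> complex vec" where
  "matrix_unit_vec n i j = unit_vec (n\<^sup>2) (i * n + j)"

definition iterated_matmul_tensor :: "nat \<Rightarrow> nat \<Rightarrow> tensor" where
  "iterated_matmul_tensor k n = (\<lambda>js. \<Sum>is\<in>set (multi_indices (replicate k n)).
     tensor_product (map (\<lambda>l. matrix_unit_vec n (is ! l) (is ! (Suc l mod k))) [0..<k]) js)"

end

theory Submission
  imports Defs "HOL-Analysis.L2_Norm"
begin

text \<open>
  Put \<open>m = c - 1\<close> and write \<open>u\<^sub>r\<close> for the uniform spectrum of length \<open>r\<close>.  The separating point is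
  \<open>(u\<^sub>2 | u\<^sub>m | u\<^sub>c | u\<^sub>1 | \<dots> | u\<^sub>1)\<close>.  Multiplication of a polynomial of degree at most \<open>1\<close> by one of degree
  less than \<open>m\<close> is a tensor of rank \<open>m + 1 = c\<close>, by evaluation at the \<open>c\<close>-th roots of unity and
  interpolation; rescaling its basis vectors makes all marginals uniform, so the point is in the
  polytope of the unit tensor.

  For the matrix multiplication tensor, two slices along the first factor are a pencil of \<open>n \<times> n\<close>
  matrices, which contains a singular \<open>X\<close>; the flattening of the corresponding slice on the second
  factor has rank at most \<open>n (n - 1) < m\<close>, and this passes to the orbit closure by compactness.
  Conversely, let \<open>S\<close> be a tensor of norm \<open>1\<close> with the marginals above.  If the slice in direction \<open>x\<close> were
  annihilated by a unit vector \<open>t\<close> of the support of the second marginal, then contracting \<open>S\<close> with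
  \<open>t\<close> would give a product vector of squared norm \<open>1 / m\<close>, whereas the third marginal bounds that
  norm by \<open>1 / c\<close>.
\<close>

section \<open>Unitary diagonalization and spectra\<close>


text \<open>The contradiction compares 1/m with 1/c, so two uniform marginals of different lengths
  are needed, and c - 1 is the largest length below c. The count n (n - 1) < m demanded by the
  linear system for t then becomes the threshold n^2 - n + 1 < c. The spectrum of length 2 is there
  because two slices are just enough to force a singular combination: det (x_0 X_0 + x_1 X_1) is a
  binary form and has a nontrivial complex zero. A spectrum determines a marginal only up to a
  unitary, whereas slices refer to coordinates. Local unitaries therefore bring all marginals of a
  point of the closure to sorted diagonal form, which turns their supports into initial segments of
  the basis. Rank conditions are replaced by unit vectors x and t, because the direction x depends
  on the tensor: tensors that admit such a witness form a projection along a product of spheres,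
  hence a closed set. Some of the local maps that act on the unit tensor are singular, so orbits
  under all matrix tuples are used; their closures agree with those of the GL orbits.\<close>

lemma mat_adjoint_carrier [simp]:
  "A \<in> carrier_mat nr nc \<Longrightarrow> mat_adjoint (A :: complex mat) \<in> carrier_mat nc nr"
  unfolding mat_adjoint_def by auto

lemma mat_adjoint_dim [simp]:
  "dim_row (mat_adjoint (A :: complex mat)) = dim_col A"
  "dim_col (mat_adjoint (A :: complex mat)) = dim_row A"
  unfolding mat_adjoint_def by auto

lemma mat_adjoint_index [simp]:
  "i < dim_col A \<Longrightarrow> j < dim_row A \<Longrightarrow> mat_adjoint A $$ (i, j) = cnj (A $$ (j, i))"
  unfolding mat_adjoint_def by (simp add: mat_of_rows_index conjugate_complex_def)

lemma mult_mat_index_sum: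
  "A \<in> carrier_mat nr m \<Longrightarrow> B \<in> carrier_mat m nc \<Longrightarrow> i < nr \<Longrightarrow> j < nc \<Longrightarrow>
    (A * B) $$ (i, j) = (\<Sum>k<m. A $$ (i, k) * B $$ (k, j))"
  by (auto simp: scalar_prod_def atLeast0LessThan intro!: sum.cong)

lemma mat_adjoint_mult:
  assumes "A \<in> carrier_mat nr m" "B \<in> carrier_mat m nc"
  shows "mat_adjoint (A * B) = mat_adjoint B * (mat_adjoint A :: complex mat)"
proof (rule eq_matI)
  fix i j assume "i < dim_row (mat_adjoint B * mat_adjoint A)" "j < dim_col (mat_adjoint B * mat_adjoint A)"
  then have ij: "i < nc" "j < nr" using assms by auto
  have "mat_adjoint (A * B) $$ (i, j) = cnj (\<Sum>k<m. A $$ (j, k) * B $$ (k, i))"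
    using ij assms by (subst mat_adjoint_index) (auto simp: mult_mat_index_sum[OF assms] simp del: index_mult_mat(1))
  also have "\<dots> = (\<Sum>k<m. mat_adjoint B $$ (i, k) * mat_adjoint A $$ (k, j))"
    using ij assms by (auto intro!: sum.cong simp: mult.commute)
  also have "\<dots> = (mat_adjoint B * mat_adjoint A) $$ (i, j)"
    using ij assms by (subst mult_mat_index_sum[of _ nc m _ nr]) auto
  finally show "mat_adjoint (A * B) $$ (i, j) = (mat_adjoint B * mat_adjoint A) $$ (i, j)" .
qed (use assms in auto)

text \<open>The Householder reflection exchanging the lines through \<open>v\<close> and the first basis vector.\<close>

lemma householder_reflection:
  fixes v :: "nat \<Rightarrow> complex"
  assumes n: "0 < n" and v: "(\<Sum>i<n. (cmod (v i))\<^sup>2) = 1"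
  obtains H s where "H \<in> carrier_mat n n" "mat_adjoint H = H" "H * H = 1\<^sub>m n"
    "\<And>i. i < n \<Longrightarrow> H $$ (i, 0) = s * v i"
proof -
  \<comment> \<open>The sign is opposite to the phase of \<open>v 0\<close>, so that
    \<open>w\<close>, which is v - s e_0, has first entry -s (1 + t) without cancellation and cannot
    vanish.\<close>
  define s where "s = (if v 0 = 0 then 1 else - sgn (v 0))"
  have s1: "s * cnj s = 1"
    by (auto simp: s_def complex_norm_square[symmetric] norm_sgn)
  have v0: "v 0 = - s * cmod (v 0)"
    by (auto simp: s_def sgn_eq)
  define t where "t = cmod (v 0)"
  have t: "t \<ge> 0" unfolding t_def by simp
  define w where "w i = v i - (if i = 0 then s else 0)" for i
  have w0: "w 0 = - s * (1 + t)" unfolding w_def t_def using v0 by (simp add: algebra_simps)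
  have "(\<Sum>i<n. w i * cnj (w i)) = w 0 * cnj (w 0) + (\<Sum>i\<in>{..<n}-{0}. w i * cnj (w i))"
    using n by (subst sum.remove[of _ 0]) auto
  also have "(\<Sum>i\<in>{..<n}-{0}. w i * cnj (w i)) = (\<Sum>i\<in>{..<n}-{0}. v i * cnj (v i))"
    by (intro sum.cong) (auto simp: w_def)
  also have "\<dots> = (\<Sum>i<n. v i * cnj (v i)) - v 0 * cnj (v 0)"
    using n by (subst (2) sum.remove[of _ 0]) auto
  also have "(\<Sum>i<n. v i * cnj (v i)) = 1"
    using arg_cong[OF v, of complex_of_real] by (simp only: of_real_sum complex_norm_square of_real_1)
  also have "v 0 * cnj (v 0) = t * t" 
    using s1 by (subst (1 2) v0) (simp add: t_def mult.assoc[symmetric] mult.commute mult.left_commute)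
  also have "w 0 * cnj (w 0) = (1 + t) * (1 + t)"
    using s1 unfolding w0 by (simp add: mult_ac)
  finally have W: "(\<Sum>i<n. w i * cnj (w i)) = 2 * (1 + t)" by (simp add: algebra_simps)
  \<comment> \<open>This is 2 / |w|^2, the coefficient that makes I - c w w^* an involution.\<close>
  define c where "c = complex_of_real (1 / (1 + t))"
  have c: "c * (1 + t) = 1" "cnj c = c"
    using t by (auto simp: c_def complex_eq_iff field_simps)
  define H where "H = mat n n (\<lambda>(i, j). (if i = j then 1 else 0) - c * w i * cnj (w j))"
  show thesis
  proof
    show HC: "H \<in> carrier_mat n n" by (simp add: H_def)
    show "mat_adjoint H = H"
      by (rule eq_matI) (auto simp: H_def c)
    show "H * H = 1\<^sub>m n"
    proof (rule eq_matI)
      fix i j assume "i < dim_row (1\<^sub>m n :: complex mat)" "j < dim_col (1\<^sub>m n :: complex mat)"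
      then have ij: "i < n" "j < n" by auto
      have "(H * H) $$ (i, j) = (\<Sum>k<n. ((if i = k then 1 else 0) - c * w i * cnj (w k)) *
            ((if k = j then 1 else 0) - c * w k * cnj (w j)))"
        using ij by (subst mult_mat_index_sum[OF HC HC]) (auto simp: H_def intro!: sum.cong)
      also have "\<dots> = (\<Sum>k<n. (if i = k then (if k = j then 1 else 0) - c * w k * cnj (w j) else 0)
          - (if k = j then c * w i * cnj (w k) else 0) + c * c * w i * cnj (w j) * (w k * cnj (w k)))"
        by (intro sum.cong) (auto simp: algebra_simps)
      also have "\<dots> = (if i = j then 1 else 0) - c * w i * cnj (w j) - c * w i * cnj (w j)
           + c * c * w i * cnj (w j) * (\<Sum>k<n. w k * cnj (w k))"
        using ij by (simp add: sum.distrib sum_subtractf sum_distrib_left)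
      also have "c * c * w i * cnj (w j) * (\<Sum>k<n. w k * cnj (w k)) = 2 * (c * w i * cnj (w j)) * (c * (1 + t))"
        unfolding W by (simp add: algebra_simps)
      finally show "(H * H) $$ (i, j) = (1\<^sub>m n :: complex mat) $$ (i, j)"
        using ij c by simp
    qed (auto simp: H_def)
    fix i assume i: "i < n"
    have "c * w i * cnj (w 0) = - w i * cnj s * (c * (1 + t))"
      unfolding w0 by simp
    also have "\<dots> = - cnj s * w i" using c by simp
    finally have "H $$ (i, 0) = (if i = 0 then 1 else 0) + cnj s * w i"
      using i n by (simp add: H_def)
    also have "\<dots> = cnj s * v i"
      using s1 unfolding w_def by (simp add: algebra_simps)
    finally show "H $$ (i, 0) = cnj s * v i" .
  qed
qed

lemma mult_block_diagonal:
  assumes "A1 \<in> carrier_mat a a" "A2 \<in> carrier_mat a a" "D1 \<in> carrier_mat d d" "D2 \<in> carrier_mat d d"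
  shows "four_block_mat A1 (0\<^sub>m a d) (0\<^sub>m d a) D1 * four_block_mat A2 (0\<^sub>m a d) (0\<^sub>m d a) D2 =
    four_block_mat (A1 * A2) (0\<^sub>m a d) (0\<^sub>m d a) (D1 * D2)"
  using mult_carrier_mat[OF assms(1,2)] mult_carrier_mat[OF assms(3,4)]
  by (subst mult_four_block_mat[OF assms(1) zero_carrier_mat zero_carrier_mat assms(3) assms(2) zero_carrier_mat zero_carrier_mat assms(4)])
    (simp add: assms left_mult_zero_mat[OF assms(4)] left_mult_zero_mat[OF assms(2)] right_mult_zero_mat[OF assms(1)] right_mult_zero_mat[OF assms(3)])

text \<open>Induction over the eigenvalues: a reflection carries the first basis vector to a unit
  eigenvector up to phase, self-adjointness clears the first row together with the first column, and
  the remaining block keeps the remaining linear factors. The order of \<open>es\<close> is free, so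
  the diagonal can later be prescribed as the sorted spectrum.\<close>

lemma hermitian_unitary_diagonalization:
  fixes A :: "complex mat"
  assumes "A \<in> carrier_mat n n" "mat_adjoint A = A" "char_poly A = (\<Prod>e\<leftarrow>es. [:- e, 1:])"
  shows "\<exists>U \<in> carrier_mat n n. mat_adjoint U * U = 1\<^sub>m n \<and>
    mat_adjoint U * A * U = mat n n (\<lambda>(i, j). if i = j then es ! i else 0)"
  using assms
proof (induction es arbitrary: n A)
  case Nil
  then have "n = 0" using degree_monic_char_poly[OF Nil.prems(1)] by simp
  then show ?case using Nil.prems by (intro bexI[of _ "1\<^sub>m 0"]) (auto intro!: eq_matI)
next
  case (Cons e es)
  note A = Cons.prems(1)
  have "degree (char_poly A) = length (e # es)"
    unfolding Cons.prems(3) by (rule degree_linear_factors)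
  then obtain n' where n: "n = Suc n'" using degree_monic_char_poly[OF A] by auto
  have "poly (char_poly A) e = 0" unfolding Cons.prems(3) by simp
  then obtain v where v: "v \<in> carrier_vec n" "v \<noteq> 0\<^sub>v n" "A *\<^sub>v v = e \<cdot>\<^sub>v v"
    using A eigenvalue_root_char_poly[OF A] unfolding eigenvalue_def eigenvector_def by auto
  define r where "r = (\<Sum>i<n. (cmod (v $ i))\<^sup>2)"
  have "r > 0"
  proof -
    obtain i where "i < n" "v $ i \<noteq> 0" using v(1,2) by (metis carrier_vecD eq_vecI index_zero_vec)
    then show ?thesis unfolding r_def by (intro sum_pos2[of _ i]) auto
  qed
  define u where "u i = v $ i / sqrt r" for i
  have "(\<Sum>i<n. (cmod (u i))\<^sup>2) = (\<Sum>i<n. (cmod (v $ i))\<^sup>2 / r)"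
    using \<open>r > 0\<close> by (intro sum.cong) (auto simp: u_def norm_divide power_divide)
  also have "\<dots> = 1" using \<open>r > 0\<close> by (simp add: r_def[symmetric] sum_divide_distrib[symmetric])
  finally obtain H s where H: "H \<in> carrier_mat n n" "mat_adjoint H = H" "H * H = 1\<^sub>m n"
    "\<And>i. i < n \<Longrightarrow> H $$ (i, 0) = s * u i"
    using householder_reflection[of n u] n by blast
  define B where "B = H * A * H"
  have B: "B \<in> carrier_mat n n" using A H by (auto simp: B_def)
  have Badj: "mat_adjoint B = B"
    using A H Cons.prems(2) unfolding B_def
    by (simp add: mat_adjoint_mult[of _ n n _ n] assoc_mult_mat[of _ n n _ n _ n])
  have AH: "(A * H) $$ (i, 0) = e * H $$ (i, 0)" if i: "i < n" for i
  proof -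
    have "(\<Sum>k<n. A $$ (i, k) * v $ k) = (A *\<^sub>v v) $ i"
      using i A v(1) by (auto simp: scalar_prod_def atLeast0LessThan intro!: sum.cong)
    then have *: "(\<Sum>k<n. A $$ (i, k) * v $ k) = e * v $ i" using v i by simp
    have "(A * H) $$ (i, 0) = (\<Sum>k<n. A $$ (i, k) * H $$ (k, 0))"
      using i n by (subst mult_mat_index_sum[OF A H(1)]) auto
    also have "\<dots> = (\<Sum>k<n. A $$ (i, k) * v $ k * (s / sqrt r))"
      by (intro sum.cong) (auto simp: H(4) u_def)
    also have "\<dots> = (\<Sum>k<n. A $$ (i, k) * v $ k) * (s / sqrt r)"
      by (simp only: sum_distrib_right)
    finally have "(A * H) $$ (i, 0) = (\<Sum>k<n. A $$ (i, k) * v $ k) * (s / sqrt r)" .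
    then show ?thesis using i H unfolding * by (simp add: u_def)
  qed
  have B0: "B $$ (i, 0) = (if i = 0 then e else 0)" if i: "i < n" for i
  proof -
    have "B $$ (i, 0) = (H * (A * H)) $$ (i, 0)"
      using A H by (simp add: B_def assoc_mult_mat[of _ n n _ n _ n])
    also have "\<dots> = (\<Sum>k<n. H $$ (i, k) * (A * H) $$ (k, 0))"
      using i n A H by (subst mult_mat_index_sum[of _ n n _ n]) auto
    also have "\<dots> = e * (\<Sum>k<n. H $$ (i, k) * H $$ (k, 0))"
      by (auto simp: AH sum_distrib_left mult_ac simp del: index_mult_mat(1) intro!: sum.cong)
    also have "(\<Sum>k<n. H $$ (i, k) * H $$ (k, 0)) = (H * H) $$ (i, 0)"
      using i n by (subst mult_mat_index_sum[OF H(1) H(1)]) auto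
    finally show ?thesis using i n H(3) by simp
  qed
  have B0': "B $$ (0, i) = (if i = 0 then cnj e else 0)" if i: "i < n" for i
    using arg_cong[OF Badj, of "\<lambda>M. M $$ (0, i)"] B0[OF i] i n B by (auto split: if_splits)
  \<comment> \<open>The corner entry is read off once from the first column and once from the first
    row, which shows that the eigenvalue is real.\<close>
  have "cnj e = e" using B0[of 0] B0'[of 0] n by simp
  define E where "E = mat 1 1 (\<lambda>_. e)"
  define A' where "A' = mat n' n' (\<lambda>(i, j). B $$ (Suc i, Suc j))"
  have E: "E \<in> carrier_mat 1 1" and A': "A' \<in> carrier_mat n' n'" by (auto simp: E_def A'_def)
  have Bb: "B = four_block_mat E (0\<^sub>m 1 n') (0\<^sub>m n' 1) A'"
    by (rule eq_matI) (use B n B0 B0' \<open>cnj e = e\<close> in \<open>auto simp: E_def A'_def four_block_mat_def Let_def\<close>)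
  have "similar_mat B A" unfolding similar_mat_def similar_mat_wit_def
    by (intro exI[of _ H]) (use A B H in \<open>auto simp: Let_def B_def\<close>)
  then have "char_poly A = char_poly B" by (simp add: char_poly_similar)
  also have "\<dots> = char_poly E * char_poly A'"
    unfolding Bb by (rule char_poly_four_block_zeros_col) (use E A' in auto)
  also have "char_poly E = [:- e, 1:]"
    by (subst char_poly_upper_triangular[OF E]) (auto simp: E_def diag_mat_def)
  finally have "char_poly A' = (\<Prod>e\<leftarrow>es. [:- e, 1:])"
    unfolding Cons.prems(3) by (simp del: mult_pCons_left)
  moreover have "mat_adjoint A' = A'"
  proof (rule eq_matI)
    fix i j assume "i < dim_row A'" "j < dim_col A'"
    then show "mat_adjoint A' $$ (i, j) = A' $$ (i, j)"
      using arg_cong[OF Badj, of "\<lambda>M. M $$ (Suc i, Suc j)"] B n by (simp add: A'_def)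
  qed (auto simp: A'_def)
  ultimately obtain U where U: "U \<in> carrier_mat n' n'" "mat_adjoint U * U = 1\<^sub>m n'"
    "mat_adjoint U * A' * U = mat n' n' (\<lambda>(i, j). if i = j then es ! i else 0)"
    using Cons.IH[OF A'] by blast
  define F where "F = four_block_mat (1\<^sub>m 1) (0\<^sub>m 1 n') (0\<^sub>m n' 1) U"
  have F: "F \<in> carrier_mat n n" using U n by (auto simp: F_def)
  have Fadj: "mat_adjoint F = four_block_mat (1\<^sub>m 1) (0\<^sub>m 1 n') (0\<^sub>m n' 1) (mat_adjoint U)"
    by (rule eq_matI) (use U in \<open>auto simp: F_def\<close>)
  have FF: "mat_adjoint F * F = 1\<^sub>m n"
    unfolding Fadj unfolding F_def
    by (subst mult_block_diagonal[where a = 1 and d = n']) (use U n in \<open>auto intro!: eq_matI\<close>)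
  have UA: "mat_adjoint U * A' \<in> carrier_mat n' n'" by (rule mult_carrier_mat[OF mat_adjoint_carrier[OF U(1)] A'])
  have "mat_adjoint F * B = four_block_mat (1\<^sub>m 1 * E) (0\<^sub>m 1 n') (0\<^sub>m n' 1) (mat_adjoint U * A')"
    unfolding Fadj Bb by (rule mult_block_diagonal[OF one_carrier_mat E mat_adjoint_carrier[OF U(1)] A'])
  then have FBF: "mat_adjoint F * B * F = four_block_mat (E * 1\<^sub>m 1) (0\<^sub>m 1 n') (0\<^sub>m n' 1) (mat_adjoint U * A' * U)"
    using mult_block_diagonal[OF E one_carrier_mat UA U(1)] unfolding F_def left_mult_one_mat[OF E] by simp
  have adj: "mat_adjoint (H * F) = mat_adjoint F * H" using H F by (simp add: mat_adjoint_mult[of _ n n _ n])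
  show ?case
  proof (intro bexI[of _ "H * F"] conjI)
    have "mat_adjoint (H * F) * (H * F) = mat_adjoint F * (H * H) * F"
      unfolding adj using H(1) F mat_adjoint_carrier[OF F] by (simp add: assoc_mult_mat[of _ n n _ n _ n])
    also have "\<dots> = 1\<^sub>m n" using FF H F mat_adjoint_carrier[OF F] by simp
    finally show "mat_adjoint (H * F) * (H * F) = 1\<^sub>m n" .
    have "mat_adjoint (H * F) * A * (H * F) = mat_adjoint F * B * F"
      unfolding adj B_def using H(1) A F mat_adjoint_carrier[OF F] by (simp add: assoc_mult_mat[of _ n n _ n _ n])
    also have "\<dots> = mat n n (\<lambda>(i, j). if i = j then (e # es) ! i else 0)"
      unfolding FBF U(3) by (rule eq_matI) (auto simp: E_def n nth_Cons' right_mult_one_mat[OF E])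
    finally show "mat_adjoint (H * F) * A * (H * F) = mat n n (\<lambda>(i, j). if i = j then (e # es) ! i else 0)" .
  qed (use H F in auto)
qed

section \<open>Spectra as sorted root lists of characteristic polynomials\<close>

lemma proots_prod_linear_factors:
  "proots (\<Prod>x\<leftarrow>xs. [:- x, 1:]) = mset (xs :: 'a :: field list)"
proof (induction xs)
  case (Cons x xs)
  have "(\<Prod>x\<leftarrow>xs. [:- x, 1:]) \<noteq> (0 :: 'a poly)" by (auto simp: prod_list_zero_iff)
  then show ?case using Cons by (simp add: proots_mult del: mult_pCons_left)
qed simp

text \<open>Uniqueness for the definite description in \<open>spec\<close>: a product of linear
  factors determines the multiset of its roots, and a non-increasing list is determined by its
  multiset.\<close>

lemma spec_eqI:
  assumes "sorted_wrt (\<ge>) xs" "char_poly A = (\<Prod>x\<leftarrow>xs. [:- complex_of_real x, 1:])"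
  shows "spec A = xs"
  unfolding spec_def
proof (rule the_equality)
  fix ys assume ys: "sorted_wrt (\<ge>) ys \<and> char_poly A = (\<Prod>x\<leftarrow>ys. [:- complex_of_real x, 1:])"
  have "proots (\<Prod>x\<leftarrow>map complex_of_real xs. [:- x, 1:]) = proots (\<Prod>x\<leftarrow>map complex_of_real ys. [:- x, 1:])"
    using assms ys by (simp add: o_def)
  then have "image_mset complex_of_real (mset xs) = image_mset complex_of_real (mset ys)"
    unfolding proots_prod_linear_factors by simp
  then have "image_mset Re (image_mset complex_of_real (mset xs)) = image_mset Re (image_mset complex_of_real (mset ys))"
    by simp
  then have "mset (rev xs) = mset (rev ys)"
    by (simp add: multiset.map_comp o_def)
  moreover have "sorted (rev xs)" "sorted (rev ys)"
    using assms ys by (auto simp: sorted_wrt_rev)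
  ultimately show "ys = xs" by (metis properties_for_sort rev_rev_ident)
qed (use assms in auto)

text \<open>Existence for the definite description in \<open>spec\<close>: a diagonal matrix
  unitarily equivalent to a Hermitian one is Hermitian again, so its entries are real and can be
  sorted.\<close>

lemma hermitian_char_poly_spec:
  assumes A: "A \<in> carrier_mat n n" "mat_adjoint A = A"
  shows "char_poly A = (\<Prod>x\<leftarrow>spec A. [:- complex_of_real x, 1:])"
proof -
  obtain es where es: "char_poly A = (\<Prod>e\<leftarrow>es. [:- e, 1:])" "length es = n"
    using char_poly_factorized[OF A(1)] by auto
  obtain U where U: "U \<in> carrier_mat n n"
    "mat_adjoint U * A * U = mat n n (\<lambda>(i, j). if i = j then es ! i else 0)"
    using hermitian_unitary_diagonalization[OF A es(1)] by auto
  have "mat_adjoint (mat_adjoint U * A * U) = mat_adjoint U * A * U"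
  proof -
    have "mat_adjoint (mat_adjoint U) = U" by (rule eq_matI) auto
    then show ?thesis using A U(1)
      by (simp add: mat_adjoint_mult[of _ n n _ n] assoc_mult_mat[of _ n n _ n _ n])
  qed
  then have "cnj (es ! i) = es ! i" if "i < n" for i
  proof -
    from \<open>mat_adjoint (mat_adjoint U * A * U) = _\<close>
    have "mat_adjoint (mat_adjoint U * A * U) $$ (i, i) = (mat_adjoint U * A * U) $$ (i, i)" by (rule arg_cong)
    then show ?thesis unfolding U(2) using that by simp
  qed
  then have "map (\<lambda>e. complex_of_real (Re e)) es = es"
    using es(2) by (intro nth_equalityI) (auto simp: complex_eq_iff)
  define xs where "xs = rev (sort (map Re es))"
  have "mset (map complex_of_real xs) = mset es"
    unfolding xs_def using \<open>map (\<lambda>e. complex_of_real (Re e)) es = es\<close>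
    by (metis (no_types, lifting) List.map.compositionality comp_apply map_eq_conv mset_map mset_rev mset_sort)
  then have "mset (map (\<lambda>x. [:- complex_of_real x, 1:]) xs) = mset (map (\<lambda>e. [:- e, 1:]) es)"
    by (metis (mono_tags, lifting) comp_apply list.map_comp map_eq_conv mset_map)
  then have cp: "char_poly A = (\<Prod>x\<leftarrow>xs. [:- complex_of_real x, 1:])"
    unfolding es(1) by (metis prod_mset_prod_list)
  moreover have "sorted_wrt (\<ge>) xs" unfolding xs_def by (simp add: sorted_wrt_rev)
  ultimately show ?thesis using spec_eqI by metis
qed

lemma hermitian_spec_diagonalization:
  assumes "A \<in> carrier_mat n n" "mat_adjoint A = A"
  obtains U where "U \<in> carrier_mat n n" "mat_adjoint U * U = 1\<^sub>m n"
    "mat_adjoint U * A * U = mat n n (\<lambda>(i, j). if i = j then map complex_of_real (spec A) ! i else 0)"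
  using hermitian_unitary_diagonalization[OF assms, of "map complex_of_real (spec A)"]
    hermitian_char_poly_spec[OF assms] by (auto simp: o_def)

lemma spec_diagonal:
  assumes "length xs = n" "sorted_wrt (\<ge>) xs"
  shows "spec (mat n n (\<lambda>(i, j). if i = j then complex_of_real (xs ! i) else 0)) = xs"
proof (rule spec_eqI[OF assms(2)])
  let ?M = "mat n n (\<lambda>(i, j). if i = j then complex_of_real (xs ! i) else 0)"
  have "diag_mat ?M = map complex_of_real xs"
    using assms by (intro nth_equalityI) (auto simp: diag_mat_def)
  moreover have "char_poly ?M = (\<Prod>a\<leftarrow>diag_mat ?M. [:- a, 1:])"
    by (rule char_poly_upper_triangular[of _ n]) (auto simp: upper_triangular_def)
  ultimately show "char_poly ?M = (\<Prod>x\<leftarrow>xs. [:- complex_of_real x, 1:])"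
    by (simp add: o_def)
qed

section \<open>Marginals of tensors of equal factor dimensions\<close>


definition cube :: "nat \<Rightarrow> nat \<Rightarrow> nat list set" where
  "cube k N = {js. length js = k \<and> (\<forall>l<k. js ! l < N)}"

lemma set_multi_indices_replicate: "set (multi_indices (replicate k N)) = cube k N"
  unfolding multi_indices_def cube_def
  by (auto simp: product_lists_set list_all2_conv_all_nth)

lemma finite_cube [simp]: "finite (cube k N)"
  by (simp flip: set_multi_indices_replicate)

lemma distinct_multi_indices: "distinct (multi_indices ns)"
  unfolding multi_indices_def by (intro distinct_product_lists) auto

lemma cube_update: "js \<in> cube k N \<Longrightarrow> a < N \<Longrightarrow> js[q := a] \<in> cube k N"
  by (cases "q < k") (auto simp: cube_def nth_list_update list_update_beyond)

text \<open>Each line in direction \<open>q\<close> is represented by its member with entry 0 at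
  \<open>q\<close>. A subset \<open>C\<close> is allowed so that a slice in one direction can be
  sliced again in another.\<close>

lemma sum_cube_slice:
  assumes C: "C \<subseteq> cube k N" "\<And>js x. js \<in> C \<Longrightarrow> x < N \<Longrightarrow> js[q := x] \<in> C" and q: "q < k"
  shows "(\<Sum>js\<in>C. F js) = (\<Sum>js\<in>{js \<in> C. js ! q = 0}. \<Sum>x<N. F (js[q := x]))"
proof -
  have "(\<Sum>js\<in>{js \<in> C. js ! q = 0}. \<Sum>x<N. F (js[q := x])) =
      (\<Sum>(js, x)\<in>{js \<in> C. js ! q = 0} \<times> {..<N}. F (js[q := x]))"
    by (rule sum.cartesian_product)
  also have "\<dots> = (\<Sum>js\<in>C. F js)"
  proof (rule sum.reindex_bij_witness[where j = "\<lambda>(js, x). js[q := x]" and i = "\<lambda>js. (js[q := 0], js ! q)"])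
    fix z assume "z \<in> {js \<in> C. js ! q = 0} \<times> {..<N}"
    then obtain js x where z: "z = (js, x)" "js \<in> C" "js ! q = 0" "x < N" by auto
    then have "q < length js" using C(1) q by (auto simp: cube_def)
    then show "((case z of (js, x) \<Rightarrow> js[q := x])[q := 0], (case z of (js, x) \<Rightarrow> js[q := x]) ! q) = z"
      using z by (simp add: z(3)[symmetric])
    show "(case z of (js, x) \<Rightarrow> js[q := x]) \<in> C" using z C(2) by simp
    show "F (case z of (js, x) \<Rightarrow> js[q := x]) = (case z of (js, x) \<Rightarrow> F (js[q := x]))" using z by simp
  next
    fix js assume js: "js \<in> C"
    then have l: "q < length js" "js ! q < N" using C(1) q by (auto simp: cube_def)
    then show "(js[q := 0], js ! q) \<in> {js \<in> C. js ! q = 0} \<times> {..<N}" using C(2)[OF js, of 0] by simp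
    show "(case (js[q := 0], js ! q) of (js, x) \<Rightarrow> js[q := x]) = js" by simp
  qed
  finally show ?thesis ..
qed

text \<open>The marginal T_q^* T_q before division by the squared norm. The indices of the other
  factors are encoded as full multi-indices with entry 0 at \<open>q\<close>, so that list updates
  replace deletion and insertion of entries.\<close>

definition gram :: "nat \<Rightarrow> nat \<Rightarrow> nat \<Rightarrow> tensor \<Rightarrow> nat \<Rightarrow> nat \<Rightarrow> complex" where
  "gram k N q S a b = (\<Sum>js\<in>{js \<in> cube k N. js ! q = 0}. cnj (S (js[q := a])) * S (js[q := b]))"

definition sqnorm :: "nat \<Rightarrow> nat \<Rightarrow> tensor \<Rightarrow> real" where
  "sqnorm k N S = (\<Sum>js\<in>cube k N. (cmod (S js))\<^sup>2)"

lemma sqnorm_eq_sum_gram: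
  assumes "q < k"
  shows "complex_of_real (sqnorm k N S) = (\<Sum>a<N. gram k N q S a a)"
proof -
  have "complex_of_real (sqnorm k N S) = (\<Sum>js\<in>cube k N. cnj (S js) * S js)"
    unfolding sqnorm_def of_real_sum by (intro sum.cong refl) (metis complex_norm_square mult.commute)
  also have "\<dots> = (\<Sum>js\<in>{js \<in> cube k N. js ! q = 0}. \<Sum>x<N. cnj (S (js[q := x])) * S (js[q := x]))"
    by (rule sum_cube_slice) (use assms cube_update in auto)
  also have "\<dots> = (\<Sum>a<N. gram k N q S a a)"
    unfolding gram_def by (rule sum.swap)
  finally show ?thesis .
qed

text \<open>A diagonal entry is the squared norm of one slice. In this way zeros in the spectrum
  will confine the support of a tensor with diagonal marginals.\<close>

lemma gram_diagonal_zero_imp: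
  assumes "gram k N q S a a = 0" "js \<in> cube k N" "js ! q = a" "q < k"
  shows "S js = 0"
proof -
  let ?C = "{js \<in> cube k N. js ! q = 0}"
  have "gram k N q S a a = complex_of_real (\<Sum>js\<in>?C. (cmod (S (js[q := a])))\<^sup>2)"
    unfolding gram_def of_real_sum by (intro sum.cong refl) (metis complex_norm_square mult.commute)
  then have "complex_of_real (\<Sum>js\<in>?C. (cmod (S (js[q := a])))\<^sup>2) = 0"
    unfolding assms(1) by (rule sym)
  then have "(\<Sum>js\<in>?C. (cmod (S (js[q := a])))\<^sup>2) = 0"
    by (rule of_real_eq_0_iff[THEN iffD1])
  then have *: "\<forall>js\<in>?C. (cmod (S (js[q := a])))\<^sup>2 = 0"
    by (subst (asm) sum_nonneg_eq_0_iff) auto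
  have "js[q := 0] \<in> ?C" using assms cube_update[of js k N 0 q] by (auto simp: cube_def)
  with * have "cmod (S (js[q := 0, q := a])) ^ 2 = 0" by blast
  moreover have "js[q := 0, q := a] = js" using assms(3) by (metis list_update_id list_update_overwrite)
  ultimately show ?thesis by simp
qed

lemma cnj_gram: "cnj (gram k N q S a b) = gram k N q S b a"
  unfolding gram_def cnj_sum by (intro sum.cong refl) simp

lemma flattening_replicate:
  assumes "q < k"
  shows "flattening (replicate k N) q S = (let rs = multi_indices (replicate (k - 1) N) in
    mat (length rs) N (\<lambda>(r, a). S (take q (rs ! r) @ a # drop q (rs ! r))))"
proof -
  have "take q (replicate k N) @ drop (Suc q) (replicate k N) = replicate (k - 1) N"
    using assms by (auto simp: min_def replicate_add[symmetric])
  then show ?thesis using assms unfolding flattening_def by simp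
qed

lemma moment_component_carrier:
  assumes "q < k"
  shows "moment_component (replicate k N) q S \<in> carrier_mat N N"
  unfolding moment_component_def flattening_replicate[OF assms] Let_def
  by (intro smult_carrier_mat mult_carrier_mat[OF mat_adjoint_carrier]) auto

lemma moment_component_index:
  assumes q: "q < k" and ab: "a < N" "b < N"
  shows "moment_component (replicate k N) q S $$ (a, b) = gram k N q S a b / sqnorm k N S"
proof -
  define rs where "rs = multi_indices (replicate (k - 1) N)"
  define ins where "ins x r = take q r @ x # drop q r" for x :: nat and r :: "nat list"
  define F where "F = mat (length rs) N (\<lambda>(r, a). S (ins a (rs ! r)))"
  have F: "F \<in> carrier_mat (length rs) N" by (simp add: F_def)
  have "tensor_norm (replicate k N) S ^ 2 = sqnorm k N S"
    unfolding tensor_norm_def sqnorm_def set_multi_indices_replicate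
    by (simp add: sum_nonneg)
  then have "moment_component (replicate k N) q S = complex_of_real (1 / sqnorm k N S) \<cdot>\<^sub>m (mat_adjoint F * F)"
    unfolding moment_component_def flattening_replicate[OF q] F_def rs_def ins_def Let_def by simp
  then have "moment_component (replicate k N) q S $$ (a, b) = (mat_adjoint F * F) $$ (a, b) / sqnorm k N S"
    using F ab by simp
  also have "(mat_adjoint F * F) $$ (a, b) = (\<Sum>r<length rs. cnj (S (ins a (rs ! r))) * S (ins b (rs ! r)))"
    using ab F by (subst mult_mat_index_sum[OF mat_adjoint_carrier[OF F] F]) (auto simp: F_def intro!: sum.cong)
  also have "\<dots> = (\<Sum>r\<in>set rs. cnj (S (ins a r)) * S (ins b r))"
    by (rule sum.reindex_bij_betw[of "\<lambda>i. rs ! i" "{..<length rs}" "set rs" "\<lambda>r. cnj (S (ins a r)) * S (ins b r)"])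
      (rule bij_betw_nth, simp_all add: rs_def distinct_multi_indices)
  also have "\<dots> = (\<Sum>r\<in>cube (k - 1) N. cnj (S (ins a r)) * S (ins b r))"
    by (simp add: rs_def set_multi_indices_replicate)
  also have "\<dots> = gram k N q S a b"
    unfolding gram_def
  \<comment> \<open>Inserting 0 at position \<open>q\<close> matches the indices of the flattening
    with the representatives used in \<open>gram\<close>.\<close>
  proof (rule sum.reindex_bij_witness[where j = "\<lambda>r. ins 0 r" and i = "\<lambda>js. take q js @ drop (Suc q) js"])
    fix r assume r: "r \<in> cube (k - 1) N"
    then have l: "length r = k - 1" by (simp add: cube_def)
    show "take q (ins 0 r) @ drop (Suc q) (ins 0 r) = r" using l q by (simp add: ins_def)
    show "ins 0 r \<in> {js \<in> cube k N. js ! q = 0}"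
      using r l q ab unfolding ins_def cube_def by (auto simp: nth_append nth_Cons' min_def)
    show "cnj (S ((ins 0 r)[q := a])) * S ((ins 0 r)[q := b]) = cnj (S (ins a r)) * S (ins b r)"
      using l q by (simp add: ins_def list_update_append)
  next
    fix js assume js: "js \<in> {js \<in> cube k N. js ! q = 0}"
    then have l: "length js = k" by (simp add: cube_def)
    show "ins 0 (take q js @ drop (Suc q) js) = js"
      using js l q by (simp add: ins_def min_def) (metis id_take_nth_drop)
    show "take q js @ drop (Suc q) js \<in> cube (k - 1) N"
      using js q unfolding cube_def by (auto simp: nth_append min_def)
  qed
  finally show ?thesis .
qed

lemma moment_component_hermitian:
  assumes "q < k"
  shows "mat_adjoint (moment_component (replicate k N) q S) = moment_component (replicate k N) q S"
  using moment_component_carrier[OF assms, of N S]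
  by (intro eq_matI) (auto simp: moment_component_index[OF assms] cnj_gram)

text \<open>Only the factor \<open>q\<close> is acted on, by the transpose of \<open>U\<close>.\<close>

definition factor_action :: "nat \<Rightarrow> nat \<Rightarrow> nat \<Rightarrow> complex mat \<Rightarrow> tensor \<Rightarrow> tensor" where
  "factor_action k N q U S = (\<lambda>js. if js \<in> cube k N then \<Sum>b<N. U $$ (b, js ! q) * S (js[q := b]) else 0)"

text \<open>The transpose in the action makes the new marginal U^* G U, the form in which
  diagonalization supplies \<open>U\<close>.\<close>

lemma gram_factor_action_same:
  assumes q: "q < k" and ab: "a < N" "b < N"
  shows "gram k N q (factor_action k N q U S) a b =
    (\<Sum>c<N. \<Sum>d<N. cnj (U $$ (c, a)) * gram k N q S c d * U $$ (d, b))"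
proof -
  let ?C = "{js \<in> cube k N. js ! q = 0}"
  have *: "factor_action k N q U S (js[q := x]) = (\<Sum>b<N. U $$ (b, x) * S (js[q := b]))"
    if "js \<in> ?C" "x < N" for js x
    using that q cube_update[of js k N x q] by (auto simp: factor_action_def cube_def)
  have "gram k N q (factor_action k N q U S) a b =
      (\<Sum>js\<in>?C. \<Sum>c<N. \<Sum>d<N. cnj (U $$ (c, a)) * (cnj (S (js[q := c])) * S (js[q := d])) * U $$ (d, b))"
    unfolding gram_def
    by (intro sum.cong refl) (simp add: * ab sum_product algebra_simps, rule sum.swap)
  also have "\<dots> = (\<Sum>c<N. \<Sum>d<N. \<Sum>js\<in>?C. cnj (U $$ (c, a)) * (cnj (S (js[q := c])) * S (js[q := d])) * U $$ (d, b))"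
    by (subst sum.swap) (intro sum.cong refl sum.swap)
  also have "\<dots> = (\<Sum>c<N. \<Sum>d<N. cnj (U $$ (c, a)) * gram k N q S c d * U $$ (d, b))"
    unfolding gram_def sum_distrib_left sum_distrib_right ..
  finally show ?thesis .
qed

text \<open>The marginal at \<open>p\<close> sums over the index of factor \<open>q\<close>, and a
  unitary on that index preserves inner products.\<close>

lemma gram_factor_action_other:
  assumes p: "p < k" and q: "q < k" "p \<noteq> q" and ab: "a < N" "b < N"
    and U: "U \<in> carrier_mat N N" "mat_adjoint U * U = 1\<^sub>m N"
  shows "gram k N p (factor_action k N q U S) a b = gram k N p S a b"
proof -
  let ?C = "{js \<in> cube k N. js ! p = 0}"
  let ?D = "{js \<in> ?C. js ! q = 0}"
  have slice: "(\<Sum>js\<in>?C. F js) = (\<Sum>js\<in>?D. \<Sum>x<N. F (js[q := x]))" for F :: "nat list \<Rightarrow> complex"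
    by (rule sum_cube_slice) (use p q cube_update in auto)
  \<comment> \<open>The summed index of factor \<open>q\<close> is the column index of
    \<open>U\<close>, which calls for unitarity in this order.\<close>
  have "U * mat_adjoint U = 1\<^sub>m N"
    using U mat_mult_left_right_inverse[of "mat_adjoint U" N U] by simp
  then have UU: "(\<Sum>x<N. U $$ (d, x) * cnj (U $$ (c, x))) = (if c = d then 1 else 0)" if "c < N" "d < N" for c d
    using that U(1) mult_mat_index_sum[OF U(1) mat_adjoint_carrier[OF U(1)], of d c] by auto
  have *: "factor_action k N q U S (js[q := x, p := y]) = (\<Sum>c<N. U $$ (c, x) * S (js[p := y, q := c]))"
    if "js \<in> ?D" "x < N" "y < N" for js x y
    using that q p cube_update[of js k N x q] cube_update[of "js[q := x]" k N y p]
    by (auto simp: factor_action_def cube_def list_update_swap)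
  have "gram k N p (factor_action k N q U S) a b =
      (\<Sum>js\<in>?D. \<Sum>x<N. cnj (factor_action k N q U S (js[q := x, p := a])) * factor_action k N q U S (js[q := x, p := b]))"
    unfolding gram_def by (rule slice)
  also have "\<dots> = (\<Sum>js\<in>?D. \<Sum>x<N. cnj (S (js[q := x, p := a])) * S (js[q := x, p := b]))"
  proof (rule sum.cong[OF refl])
    fix js assume js: "js \<in> ?D"
    let ?s = "\<lambda>y c. S (js[p := y, q := c])"
    have "(\<Sum>x<N. cnj (factor_action k N q U S (js[q := x, p := a])) * factor_action k N q U S (js[q := x, p := b]))
       = (\<Sum>x<N. \<Sum>c<N. \<Sum>d<N. cnj (?s a c) * ?s b d * (U $$ (d, x) * cnj (U $$ (c, x))))"
      by (intro sum.cong refl) (simp add: *[OF js] ab sum_product algebra_simps, rule sum.swap)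
    also have "\<dots> = (\<Sum>c<N. \<Sum>d<N. \<Sum>x<N. cnj (?s a c) * ?s b d * (U $$ (d, x) * cnj (U $$ (c, x))))"
      by (subst sum.swap) (intro sum.cong refl sum.swap)
    also have "\<dots> = (\<Sum>c<N. \<Sum>d<N. cnj (?s a c) * ?s b d * (if c = d then 1 else 0))"
      unfolding sum_distrib_left[symmetric] by (intro sum.cong refl) (simp add: UU)
    also have "\<dots> = (\<Sum>c<N. \<Sum>d<N. if c = d then cnj (?s a c) * ?s b d else 0)"
      by (intro sum.cong refl) simp
    also have "\<dots> = (\<Sum>c<N. cnj (?s a c) * ?s b c)" by simp
    finally show "(\<Sum>x<N. cnj (factor_action k N q U S (js[q := x, p := a])) * factor_action k N q U S (js[q := x, p := b]))
        = (\<Sum>x<N. cnj (S (js[q := x, p := a])) * S (js[q := x, p := b]))"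
      using q by (simp add: list_update_swap)
  qed
  also have "\<dots> = gram k N p S a b"
    unfolding gram_def by (rule slice[symmetric])
  finally show ?thesis .
qed

section \<open>Orbits under matrix tuples and diagonal representatives\<close>

lemma local_action_replicate:
  "local_action (replicate k N) gs T = (\<lambda>is. if is \<in> cube k N
     then \<Sum>js\<in>cube k N. (\<Prod>l<k. (gs ! l) $$ (is ! l, js ! l)) * T js else 0)"
  unfolding local_action_def set_multi_indices_replicate length_replicate ..

definition matrix_orbit :: "nat \<Rightarrow> nat \<Rightarrow> tensor \<Rightarrow> tensor set" where
  "matrix_orbit k N T = {local_action (replicate k N) gs T | gs.
     length gs = k \<and> (\<forall>l<k. gs ! l \<in> carrier_mat N N)}"

lemma GL_orbit_subset_matrix_orbit: "GL_orbit (replicate k N) T \<subseteq> matrix_orbit k N T"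
  unfolding GL_orbit_def matrix_orbit_def GL_product_def by auto

lemma factor_action_local_action:
  assumes gs: "length gs = k" "\<forall>l<k. gs ! l \<in> carrier_mat N N" and U: "U \<in> carrier_mat N N" and q: "q < k"
  shows "factor_action k N q U (local_action (replicate k N) gs T) =
    local_action (replicate k N) (gs[q := transpose_mat U * gs ! q]) T"
proof
  fix js
  let ?hs = "gs[q := transpose_mat U * gs ! q]"
  show "factor_action k N q U (local_action (replicate k N) gs T) js = local_action (replicate k N) ?hs T js"
  proof (cases "js \<in> cube k N")
    case True
    then have jq: "js ! q < N" and len: "length js = k" using q by (auto simp: cube_def)
    have "factor_action k N q U (local_action (replicate k N) gs T) js =
        (\<Sum>b<N. U $$ (b, js ! q) * (\<Sum>is\<in>cube k N. (\<Prod>l<k. (gs ! l) $$ (js[q := b] ! l, is ! l)) * T is))"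
      using True by (auto simp: factor_action_def local_action_replicate cube_update intro!: sum.cong)
    also have "\<dots> = (\<Sum>is\<in>cube k N. (\<Sum>b<N. U $$ (b, js ! q) * (\<Prod>l<k. (gs ! l) $$ (js[q := b] ! l, is ! l))) * T is)"
      unfolding sum_distrib_left sum_distrib_right by (subst sum.swap) (simp add: mult.assoc)
    also have "\<dots> = (\<Sum>is\<in>cube k N. (\<Prod>l<k. (?hs ! l) $$ (js ! l, is ! l)) * T is)"
    proof (intro sum.cong refl arg_cong2[where f = "(*)"])
      fix "is" assume "is \<in> cube k N"
      then have iq: "is ! q < N" using q by (auto simp: cube_def)
      let ?P = "\<Prod>l\<in>{..<k}-{q}. (gs ! l) $$ (js ! l, is ! l)"
      have gq: "gs ! q \<in> carrier_mat N N" using gs q by simp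
      have "(\<Prod>l<k. (gs ! l) $$ (js[q := b] ! l, is ! l)) = (gs ! q) $$ (b, is ! q) * ?P" for b
        using q len by (subst prod.remove[of _ q]) (auto intro!: prod.cong arg_cong2[where f = "(*)"])
      then have "(\<Sum>b<N. U $$ (b, js ! q) * (\<Prod>l<k. (gs ! l) $$ (js[q := b] ! l, is ! l))) =
          (\<Sum>b<N. transpose_mat U $$ (js ! q, b) * (gs ! q) $$ (b, is ! q)) * ?P"
        using U jq by (simp add: sum_distrib_right mult.assoc)
      also have "(\<Sum>b<N. transpose_mat U $$ (js ! q, b) * (gs ! q) $$ (b, is ! q)) = (transpose_mat U * gs ! q) $$ (js ! q, is ! q)"
        using jq iq U by (subst mult_mat_index_sum[OF _ gq]) auto
      also have "\<dots> * ?P = (\<Prod>l<k. (?hs ! l) $$ (js ! l, is ! l))"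
        using q gs by (subst (2) prod.remove[of _ q]) (auto intro!: prod.cong)
      finally show "(\<Sum>b<N. U $$ (b, js ! q) * (\<Prod>l<k. (gs ! l) $$ (js[q := b] ! l, is ! l))) =
          (\<Prod>l<k. (?hs ! l) $$ (js ! l, is ! l))" .
    qed
    also have "\<dots> = local_action (replicate k N) ?hs T js"
      using True by (simp add: local_action_replicate)
    finally show ?thesis .
  qed (simp add: factor_action_def local_action_replicate)
qed

lemma continuous_on_factor_action: "continuous_on A (factor_action k N q U)"
proof (rule continuous_on_coordinatewise_then_product)
  fix js
  show "continuous_on A (\<lambda>S. factor_action k N q U S js)"
    unfolding factor_action_def
    by (cases "js \<in> cube k N") (auto intro!: continuous_intros continuous_on_subset[OF continuous_on_product_coordinates])
qed

lemma factor_action_closure: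
  assumes "S \<in> closure (matrix_orbit k N T)" "U \<in> carrier_mat N N" "q < k"
  shows "factor_action k N q U S \<in> closure (matrix_orbit k N T)"
proof -
  have "factor_action k N q U ` matrix_orbit k N T \<subseteq> matrix_orbit k N T"
  proof safe
    fix R assume "R \<in> matrix_orbit k N T"
    then obtain gs where gs: "length gs = k" "\<forall>l<k. gs ! l \<in> carrier_mat N N"
      "R = local_action (replicate k N) gs T" unfolding matrix_orbit_def by auto
    have "\<forall>l<k. gs[q := transpose_mat U * gs ! q] ! l \<in> carrier_mat N N"
      using gs assms by (auto simp: nth_list_update)
    then show "factor_action k N q U R \<in> matrix_orbit k N T"
      unfolding gs(3) factor_action_local_action[OF gs(1,2) assms(2,3)] matrix_orbit_def
      using gs(1) by (auto intro!: exI[of _ "gs[q := transpose_mat U * gs ! q]"])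
  qed
  then have "factor_action k N q U ` closure (matrix_orbit k N T) \<subseteq> closure (matrix_orbit k N T)"
    using closure_subset[of "matrix_orbit k N T"]
    by (intro image_closure_subset continuous_on_factor_action) auto
  then show ?thesis using assms(1) by auto
qed

text \<open>One factor is treated at a time. Since each unitary leaves the other marginals alone,
  all of them can be taken from the diagonalizations of the marginals of \<open>S\<close>
  itself.\<close>

lemma diagonal_representative:
  assumes S: "S \<in> closure (matrix_orbit k N T)" and pos: "sqnorm k N S > 0"
  obtains R where "R \<in> closure (matrix_orbit k N T)"
    "\<And>q a b. q < k \<Longrightarrow> a < N \<Longrightarrow> b < N \<Longrightarrow> gram k N q R a b =
       (if a = b then complex_of_real (sqnorm k N S * spec (moment_component (replicate k N) q S) ! a) else 0)"
proof -
  let ?d = "\<lambda>q. spec (moment_component (replicate k N) q S)"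
  have "\<exists>R \<in> closure (matrix_orbit k N T). (\<forall>q<k. \<forall>a<N. \<forall>b<N. gram k N q R a b =
      (if q < r then if a = b then complex_of_real (sqnorm k N S * ?d q ! a) else 0 else gram k N q S a b))"
    if "r \<le> k" for r
    using that
  proof (induction r)
    case 0
    then show ?case using S by auto
  next
    case (Suc r)
    then obtain R where R: "R \<in> closure (matrix_orbit k N T)"
      "\<And>q a b. q < k \<Longrightarrow> a < N \<Longrightarrow> b < N \<Longrightarrow> gram k N q R a b =
      (if q < r then if a = b then complex_of_real (sqnorm k N S * ?d q ! a) else 0 else gram k N q S a b)"
      by fastforce
    have r: "r < k" using Suc by simp
    let ?A = "moment_component (replicate k N) r S"
    have A: "?A \<in> carrier_mat N N" by (rule moment_component_carrier[OF r])
    obtain U where U: "U \<in> carrier_mat N N" "mat_adjoint U * U = 1\<^sub>m N"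
      "mat_adjoint U * ?A * U = mat N N (\<lambda>(i, j). if i = j then map complex_of_real (spec ?A) ! i else 0)"
      using hermitian_spec_diagonalization[OF A moment_component_hermitian[OF r]] by blast
    have len: "length (spec ?A) = N"
    proof -
      have "degree (char_poly ?A) = length (spec ?A)"
        unfolding hermitian_char_poly_spec[OF A moment_component_hermitian[OF r]]
        using degree_linear_factors[of "\<lambda>x. - x" "map complex_of_real (spec ?A)"] by (simp add: o_def)
      then show ?thesis using degree_monic_char_poly[OF A] by simp
    qed
    show ?case
    proof (intro bexI[of _ "factor_action k N r U R"] allI impI)
      show "factor_action k N r U R \<in> closure (matrix_orbit k N T)"
        by (rule factor_action_closure[OF R(1) U(1) r])
      fix q a b assume q: "q < k" and ab: "a < N" "b < N"
      show "gram k N q (factor_action k N r U R) a b =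
        (if q < Suc r then if a = b then complex_of_real (sqnorm k N S * ?d q ! a) else 0 else gram k N q S a b)"
      proof (cases "q = r")
        case False
        then show ?thesis using gram_factor_action_other[OF q r False ab U(1,2)] R(2)[OF q ab] by simp
      next
        case True
        have "gram k N r (factor_action k N r U R) a b =
            (\<Sum>c<N. \<Sum>d<N. cnj (U $$ (c, a)) * (sqnorm k N S * ?A $$ (c, d)) * U $$ (d, b))"
          using r pos by (auto simp: gram_factor_action_same[OF r ab] R(2)[OF r] moment_component_index[OF r] intro!: sum.cong)
        also have "\<dots> = sqnorm k N S * (\<Sum>d<N. (\<Sum>c<N. cnj (U $$ (c, a)) * ?A $$ (c, d)) * U $$ (d, b))"
          by (subst sum.swap) (simp add: sum_distrib_left sum_distrib_right mult_ac)
        also have "(\<Sum>d<N. (\<Sum>c<N. cnj (U $$ (c, a)) * ?A $$ (c, d)) * U $$ (d, b)) =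
            (\<Sum>d<N. (mat_adjoint U * ?A) $$ (a, d) * U $$ (d, b))"
          using U(1) ab A by (intro sum.cong refl)
            (auto simp: mult_mat_index_sum[OF mat_adjoint_carrier[OF U(1)] A] simp del: index_mult_mat(1))
        also have "\<dots> = (mat_adjoint U * ?A * U) $$ (a, b)"
          using U(1) A ab by (subst mult_mat_index_sum[of _ N N U N]) auto
        finally show ?thesis unfolding U(3) using True ab len by simp
      qed
    qed
  qed
  from this[of k] show thesis using that by auto
qed

section \<open>Singular slices in the orbit closure of matrix multiplication\<close>


text \<open>Tube lemma: a point outside the projection has, for every \<open>x\<close> in
  \<open>K\<close>, a product neighbourhood that misses \<open>C\<close>; finitely many first sides
  cover \<open>K\<close>, and the intersection of their second sides misses the projection.\<close>

lemma closed_Bex_compact: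
  fixes C :: "('a::topological_space \<times> 'b::topological_space) set"
  assumes "compact K" "closed C"
  shows "closed {y. \<exists>x\<in>K. (x, y) \<in> C}"
proof -
  have "open (- {y. \<exists>x\<in>K. (x, y) \<in> C})"
  proof (rule openI)
    fix y assume y: "y \<in> - {y. \<exists>x\<in>K. (x, y) \<in> C}"
    have "\<exists>A B. open A \<and> open B \<and> x \<in> A \<and> y \<in> B \<and> A \<times> B \<subseteq> - C" if "x \<in> K" for x
    proof -
      have "open (- C)" "(x, y) \<in> - C" using that y assms(2) by auto
      then obtain A B where "open A" "open B" "(x, y) \<in> A \<times> B" "A \<times> B \<subseteq> - C" by (rule open_prod_elim)
      then show ?thesis by (intro exI[of _ A] exI[of _ B]) auto
    qed
    then obtain A B where AB: "\<And>x. x \<in> K \<Longrightarrow> open (A x) \<and> open (B x) \<and> x \<in> A x \<and> y \<in> B x \<and> A x \<times> B x \<subseteq> - C"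
      by metis
    obtain F where F: "F \<subseteq> K" "finite F" "K \<subseteq> \<Union> (A ` F)"
      using compactE_image[OF assms(1), of K A] AB by blast
    show "\<exists>V. open V \<and> y \<in> V \<and> V \<subseteq> - {y. \<exists>x\<in>K. (x, y) \<in> C}"
    proof (intro exI[of _ "\<Inter> (B ` F)"] conjI)
      show "open (\<Inter> (B ` F))" using F AB by (intro open_INT) auto
      show "y \<in> \<Inter> (B ` F)" using F AB by auto
      show "\<Inter> (B ` F) \<subseteq> - {y. \<exists>x\<in>K. (x, y) \<in> C}"
      proof (safe, goal_cases)
        case (1 z x)
        then obtain w where "w \<in> F" "x \<in> A w" using F by auto
        then have "(x, z) \<in> A w \<times> B w" "A w \<times> B w \<subseteq> - C" using AB[of w] F(1) 1 by auto
        then show ?case using \<open>(x, z) \<in> C\<close> by blast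
      qed
    qed
  qed
  then show ?thesis by (simp add: closed_def)
qed

text \<open>Setting the coordinates from \<open>m\<close> on to 0 makes the sphere a closed subset
  of a product of compact squares, to which Tychonoff's theorem applies.\<close>

lemma compact_unit_vectors:
  "compact {x :: nat \<Rightarrow> complex. (\<forall>i. i \<ge> m \<longrightarrow> x i = 0) \<and> (\<Sum>i<m. (cmod (x i))\<^sup>2) = 1}" (is "compact ?K")
proof -
  let ?Q = "(\<lambda>(a, b). Complex a b) ` ({-1..1} \<times> {-1..1})"
  let ?B = "PiE UNIV (\<lambda>_::nat. ?Q)"
  have "(\<lambda>(a, b). Complex a b) = (\<lambda>z. complex_of_real (fst z) + \<i> * complex_of_real (snd z))"
    by (auto simp: fun_eq_iff complex_eq_iff)
  then have "compact ?Q"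
    by (intro compact_continuous_image compact_Times compact_Icc) (auto intro!: continuous_intros)
  then have "compactin (product_topology (\<lambda>_. euclidean) UNIV) ?B"
    by (subst compactin_PiE) auto
  then have "compact ?B" by (simp add: euclidean_product_topology)
  moreover have "closed ?K"
  proof -
    have *: "continuous_on UNIV (\<lambda>x :: nat \<Rightarrow> complex. x i)" for i
      by (rule continuous_on_product_coordinates)
    have "?K = (\<Inter>i\<in>{m..}. {x. x i = 0}) \<inter> {x. (\<Sum>i<m. (cmod (x i))\<^sup>2) = 1}" by auto
    also have "closed \<dots>"
      by (intro closed_Int closed_INT ballI closed_Collect_eq continuous_intros *)
    finally show ?thesis .
  qed
  moreover have "?K \<subseteq> ?B"
  proof
    fix x assume x: "x \<in> ?K"
    have "cmod (x i) \<le> 1" for i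
    proof (cases "i < m")
      case True
      then have "(cmod (x i))\<^sup>2 \<le> (\<Sum>i<m. (cmod (x i))\<^sup>2)" by (intro member_le_sum) auto
      then show ?thesis using x by (simp add: power_le_one_iff abs_square_le_1)
    qed (use x in auto)
    then have "Re (x i) \<in> {-1..1}" "Im (x i) \<in> {-1..1}" for i
      using abs_Re_le_cmod[of "x i"] abs_Im_le_cmod[of "x i"] by (smt (verit) atLeastAtMost_iff)+
    then have "x i \<in> ?Q" for i
      by (intro image_eqI[of _ _ "(Re (x i), Im (x i))"]) auto
    then show "x \<in> ?B" by blast
  qed
  ultimately have "compact (?B \<inter> ?K)" "?B \<inter> ?K = ?K" by (auto intro: compact_Int_closed)
  then show ?thesis by (simp only:)
qed

section \<open>Linear systems and pencils of matrices\<close>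

lemma exists_unit_multiple:
  fixes x :: "nat \<Rightarrow> complex"
  assumes "\<exists>i<m. x i \<noteq> 0"
  obtains c where "c \<noteq> 0" "(\<Sum>i<m. (cmod (c * x i))\<^sup>2) = 1"
proof -
  define r where "r = (\<Sum>i<m. (cmod (x i))\<^sup>2)"
  have "r > 0" using assms unfolding r_def by (auto intro: sum_pos2)
  have "(\<Sum>i<m. (cmod (complex_of_real (1 / sqrt r) * x i))\<^sup>2) = (\<Sum>i<m. (cmod (x i))\<^sup>2 / r)"
    using \<open>r > 0\<close> by (intro sum.cong) (auto simp: norm_mult norm_divide power_divide)
  also have "\<dots> = 1" using \<open>r > 0\<close> by (simp add: r_def[symmetric] sum_divide_distrib[symmetric])
  finally show thesis using that[of "complex_of_real (1 / sqrt r)"] \<open>r > 0\<close> by simp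
qed

text \<open>Padding the equations with zero rows gives a square matrix of determinant 0, whose
  kernel contains the solution.\<close>

lemma underdetermined_system:
  fixes a :: "'e \<Rightarrow> nat \<Rightarrow> 'a::field"
  assumes "finite E" "card E < m"
  obtains t where "\<exists>j<m. t j \<noteq> 0" "\<forall>e\<in>E. (\<Sum>j<m. a e j * t j) = 0"
proof -
  obtain f where f: "bij_betw f {..<card E} E"
    using assms(1) ex_bij_betw_nat_finite by (metis atLeast0LessThan)
  define A where "A = mat m m (\<lambda>(i, j). if i < card E then a (f i) j else 0)"
  have A: "A \<in> carrier_mat m m" "transpose_mat A \<in> carrier_mat m m" by (auto simp: A_def)
  \<comment> \<open>Row \<open>card E\<close> is the first of the zero rows; it exists because there
    are fewer equations than unknowns.\<close>
  have "transpose_mat A *\<^sub>v unit_vec m (card E) = 0\<^sub>v m"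
    using assms by (intro eq_vecI) (auto simp: A_def)
  moreover have "unit_vec m (card E) \<noteq> (0\<^sub>v m :: 'a vec)" using assms
    by (metis index_unit_vec(1) index_zero_vec(1) one_neq_zero)
  ultimately have "det (transpose_mat A) = 0"
    using det_0_iff_vec_prod_zero_field[OF A(2)] by (metis unit_vec_carrier)
  then have "det A = 0" using det_transpose[OF A(1)] by simp
  then obtain v where v: "v \<in> carrier_vec m" "v \<noteq> 0\<^sub>v m" "A *\<^sub>v v = 0\<^sub>v m"
    using det_0_iff_vec_prod_zero_field[OF A(1)] by auto
  show thesis
  proof
    show "\<exists>j<m. v $ j \<noteq> 0" using v by (metis carrier_vecD eq_vecI index_zero_vec)
    show "\<forall>e\<in>E. (\<Sum>j<m. a e j * v $ j) = 0"
    proof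
      fix e assume "e \<in> E"
      then obtain i where i: "i < card E" "e = f i" using f by (auto simp: bij_betw_def)
      then have "(A *\<^sub>v v) $ i = (\<Sum>j<m. a e j * v $ j)"
        using assms v(1) by (auto simp: A_def scalar_prod_def atLeast0LessThan intro!: sum.cong)
      then show "(\<Sum>j<m. a e j * v $ j) = 0" using v(3) i assms by simp
    qed
  qed
qed

text \<open>Either the second matrix is singular, or it is inverted and an eigenvalue
  \<open>e\<close> of the quotient makes the first minus \<open>e\<close> times the second singular.
  The vector \<open>y\<close> is a left null vector of the combination.\<close>

lemma singular_pencil_member:
  fixes X :: "nat \<Rightarrow> nat \<Rightarrow> nat \<Rightarrow> complex"
  assumes n: "0 < n"
  obtains x y where "\<exists>i<2. x i \<noteq> 0" "\<exists>p<n. y p \<noteq> 0"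
    "\<forall>q<n. (\<Sum>p<n. y p * (\<Sum>i<2. x i * X i p q)) = 0"
proof -
  \<comment> \<open>Transposed, so that a right null vector here is a left null vector of the
    original matrices.\<close>
  define A where "A i = mat n n (\<lambda>(q, p). X i p q)" for i
  have A: "A i \<in> carrier_mat n n" for i by (simp add: A_def)
  have Av: "(A i *\<^sub>v v) $ q = (\<Sum>p<n. v $ p * X i p q)" if "v \<in> carrier_vec n" "q < n" for i v q
    using that by (auto simp: A_def scalar_prod_def atLeast0LessThan mult.commute intro!: sum.cong)
  have nz: "\<exists>p<n. v $ p \<noteq> 0" if "v \<in> carrier_vec n" "v \<noteq> 0\<^sub>v n" for v :: "complex vec"
    using that by (metis carrier_vecD eq_vecI index_zero_vec)
  show thesis
  proof (cases "det (A 1) = 0")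
    case True
    then obtain v where v: "v \<in> carrier_vec n" "v \<noteq> 0\<^sub>v n" "A 1 *\<^sub>v v = 0\<^sub>v n"
      using det_0_iff_vec_prod_zero_field[OF A] by metis
    show thesis
    proof (rule that[of "\<lambda>i. if i = 1 then 1 else 0" "\<lambda>p. v $ p"]; (intro allI impI)?)
      fix q assume "q < n"
      then have "(\<Sum>p<n. v $ p * X 1 p q) = 0" using Av[OF v(1), of q 1] v(3) by simp
      then show "(\<Sum>p<n. v $ p * (\<Sum>i<2. (if i = 1 then 1 else 0) * X i p q)) = 0"
        by (simp add: numeral_2_eq_2)
    qed (use nz[OF v(1,2)] in auto)
  next
    case False
    then obtain B where B: "B \<in> carrier_mat n n" "A 1 * B = 1\<^sub>m n"
      using det_non_zero_imp_unit[OF A[of 1] False, of "()"] unfolding Units_def ring_mat_def by auto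
    define D where "D = B * A 0"
    have D: "D \<in> carrier_mat n n" unfolding D_def using B A by auto
    obtain es where es: "char_poly D = (\<Prod>a\<leftarrow>es. [:- a, 1:])" "length es = n"
      using char_poly_factorized[OF D] by auto
    then obtain e es' where "es = e # es'" using n by (cases es) auto
    then have "poly (char_poly D) e = 0" using es by simp
    then obtain v where v: "v \<in> carrier_vec n" "v \<noteq> 0\<^sub>v n" "D *\<^sub>v v = e \<cdot>\<^sub>v v"
      using D eigenvalue_root_char_poly[OF D] unfolding eigenvalue_def eigenvector_def by auto
    have "A 0 *\<^sub>v v = (A 1 * B) *\<^sub>v (A 0 *\<^sub>v v)"
      using A[of 0] v B by simp
    also have "\<dots> = A 1 *\<^sub>v (D *\<^sub>v v)"
      using A[of 0] A[of 1] B(1) v(1) unfolding D_def by (simp add: assoc_mult_mat_vec[of _ n n _ n])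
    also have "\<dots> = e \<cdot>\<^sub>v (A 1 *\<^sub>v v)"
      unfolding v(3) by (rule mult_mat_vec[OF A v(1)])
    finally have eq: "A 0 *\<^sub>v v = e \<cdot>\<^sub>v (A 1 *\<^sub>v v)" .
    show thesis
    proof (rule that[of "\<lambda>i. if i = 0 then 1 else - e" "\<lambda>p. v $ p"]; (intro allI impI)?)
      fix q assume q: "q < n"
      then have "(\<Sum>p<n. v $ p * X 0 p q) = e * (\<Sum>p<n. v $ p * X 1 p q)"
        using arg_cong[OF eq, of "\<lambda>u. u $ q"] A[of 1] Av[OF v(1) q] by auto
      then show "(\<Sum>p<n. v $ p * (\<Sum>i<2. (if i = 0 then 1 else - e) * X i p q)) = 0"
        by (simp add: numeral_2_eq_2 algebra_simps sum.distrib sum_subtractf sum_distrib_left)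
    qed (use nz[OF v(1,2)] in auto)
  qed
qed

text \<open>
  Some nonzero combination \<open>X\<close> of the \<open>X\<^sub>i\<close> is singular, so one of its rows depends on the others and
  \<open>X W = 0\<close> amounts to only \<open>n (n - 1)\<close> linear equations on \<open>W\<close>.
\<close>

lemma pencil_annihilator:
  fixes X W :: "nat \<Rightarrow> nat \<Rightarrow> nat \<Rightarrow> complex"
  assumes n: "0 < n" and m: "(n - 1) * n < m"
  obtains x t where "(\<Sum>i<2. (cmod (x i))\<^sup>2) = 1" "(\<Sum>j<m. (cmod (t j))\<^sup>2) = 1"
    "\<forall>p<n. \<forall>r<n. (\<Sum>q<n. (\<Sum>i<2. x i * X i p q) * (\<Sum>j<m. t j * W j q r)) = 0"
proof -
  obtain x y where x: "\<exists>i<2. x i \<noteq> 0" and y: "\<exists>p<n. y p \<noteq> 0"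
    and xy: "\<forall>q<n. (\<Sum>p<n. y p * (\<Sum>i<2. x i * X i p q)) = 0"
    by (rule singular_pencil_member[OF n, of X])
  obtain p0 where p0: "p0 < n" "y p0 \<noteq> 0" using y by auto
  let ?X = "\<lambda>p q. \<Sum>i<2. x i * X i p q"
  \<comment> \<open>Since \<open>y p0\<close> is nonzero, row \<open>p0\<close> of the singular
    combination depends on the other rows, and its \<open>n\<close> equations can be left
    out.\<close>
  let ?E = "({..<n} - {p0}) \<times> {..<n}"
  have "card ?E < m" using m p0 by (simp add: card_cartesian_product)
  then obtain t where t: "\<exists>j<m. t j \<noteq> 0"
    "\<forall>e\<in>?E. (\<Sum>j<m. (case e of (p, r) \<Rightarrow> \<Sum>q<n. ?X p q * W j q r) * t j) = 0"
    by (rule underdetermined_system[of ?E m "\<lambda>e j. case e of (p, r) \<Rightarrow> \<Sum>q<n. ?X p q * W j q r", rotated]) auto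
  let ?Y = "\<lambda>p r. \<Sum>q<n. ?X p q * (\<Sum>j<m. t j * W j q r)"
  have Y: "?Y p r = (\<Sum>j<m. (\<Sum>q<n. ?X p q * W j q r) * t j)" for p r
    unfolding sum_distrib_left[of _ _ "{..<m}"] sum_distrib_right[of _ "{..<n}"]
    by (subst sum.swap) (simp add: mult_ac)
  have Y0: "?Y p r = 0" if p: "p < n" and r: "r < n" for p r
  proof (cases "p = p0")
    case False
    then show ?thesis unfolding Y using bspec[OF t(2), of "(p, r)"] p r by simp
  next
    case True
    \<comment> \<open>The rows of the product, weighted by \<open>y\<close>, add up to 0, and all
      but row \<open>p0\<close> are already known to vanish.\<close>
    have "(\<Sum>p<n. y p * ?Y p r) = (\<Sum>q<n. (\<Sum>p<n. y p * ?X p q) * (\<Sum>j<m. t j * W j q r))"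
      unfolding sum_distrib_left[of _ _ "{..<n}"] sum_distrib_right[of _ "{..<n}"]
      by (subst sum.swap) (simp add: mult.assoc)
    also have "\<dots> = 0" using xy by simp
    also have "(\<Sum>p<n. y p * ?Y p r) = y p0 * ?Y p0 r + (\<Sum>p\<in>{..<n}-{p0}. y p * ?Y p r)"
      using p0 by (subst sum.remove[of _ p0]) auto
    also have "(\<Sum>p\<in>{..<n}-{p0}. y p * ?Y p r) = 0"
      unfolding Y using t(2) r by (intro sum.neutral) auto
    finally show ?thesis using p0 True by simp
  qed
  obtain c where c: "(\<Sum>i<2. (cmod (c * x i))\<^sup>2) = 1" by (rule exists_unit_multiple[OF x])
  obtain d where d: "(\<Sum>j<m. (cmod (d * t j))\<^sup>2) = 1" by (rule exists_unit_multiple[OF t(1)])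
  show thesis
  proof (rule that[OF c d], intro allI impI)
    fix p r assume pr: "p < n" "r < n"
    have "(\<Sum>q<n. (\<Sum>i<2. c * x i * X i p q) * (\<Sum>j<m. d * t j * W j q r)) = c * d * ?Y p r"
      by (simp add: sum_distrib_left mult_ac)
    then show "(\<Sum>q<n. (\<Sum>i<2. c * x i * X i p q) * (\<Sum>j<m. d * t j * W j q r)) = 0"
      using Y0[OF pr] by simp
  qed
qed

section \<open>Coordinates of tensors in the orbit of matrix multiplication\<close>

lemma tensor_product_unit_vecs:
  assumes "\<And>l. l < k \<Longrightarrow> h l < N"
  shows "tensor_product (map (\<lambda>l. unit_vec N (h l)) [0..<k]) js = (if js = map h [0..<k] then 1 else 0)"
proof -
  have "map dim_vec (map (\<lambda>l. unit_vec N (h l) :: complex vec) [0..<k]) = replicate k N"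
    by (intro nth_equalityI) auto
  then have *: "tensor_product (map (\<lambda>l. unit_vec N (h l)) [0..<k]) js =
      (if js \<in> cube k N then \<Prod>l<k. unit_vec N (h l) $ (js ! l) else 0)"
    unfolding tensor_product_def set_multi_indices_replicate[symmetric] by simp
  show ?thesis
  proof (cases "js = map h [0..<k]")
    case True
    then have js: "js \<in> cube k N" using assms by (simp add: cube_def)
    have "(\<Prod>l<k. unit_vec N (h l) $ (js ! l)) = (1 :: complex)"
      using True assms by (intro prod.neutral) simp
    then show ?thesis unfolding * if_P[OF js] using True by (simp only: refl if_True)
  next
    case False
    have "(\<Prod>l<k. unit_vec N (h l) $ (js ! l)) = (0 :: complex)" if js: "js \<in> cube k N"
    proof -
      have len: "length js = k" using js by (simp add: cube_def)
      have "\<exists>l<k. js ! l \<noteq> h l"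
      proof (rule ccontr)
        assume "\<not> (\<exists>l<k. js ! l \<noteq> h l)"
        then have "js = map h [0..<k]" using len by (intro nth_equalityI) simp_all
        then show False using False by (rule notE[rotated])
      qed
      then obtain l where "l < k" "js ! l \<noteq> h l" by blast
      then show ?thesis using js assms[of l] by (intro prod_zero bexI[of _ l]) (auto simp: cube_def)
    qed
    then show ?thesis unfolding * using False by auto
  qed
qed

text \<open>Serves both tensors of the theorem, as each is a sum of basis tensors. Summation over
  labels in \<open>P\<close> counts repeated multi-indices correctly, so injectivity of
  \<open>f\<close> is not at issue.\<close>

lemma local_action_sum_basis:
  assumes "finite P" "\<And>p. p \<in> P \<Longrightarrow> f p \<in> cube k N" "js \<in> cube k N"
    "\<And>is. T is = (\<Sum>p\<in>P. if is = f p then 1 else 0)"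
  shows "local_action (replicate k N) gs T js = (\<Sum>p\<in>P. \<Prod>l<k. (gs ! l) $$ (js ! l, f p ! l))"
proof -
  have "local_action (replicate k N) gs T js =
      (\<Sum>is\<in>cube k N. \<Sum>p\<in>P. if is = f p then \<Prod>l<k. (gs ! l) $$ (js ! l, is ! l) else 0)"
    using assms(3) by (auto simp: local_action_replicate assms(4) sum_distrib_left intro!: sum.cong)
  also have "\<dots> = (\<Sum>p\<in>P. \<Sum>is\<in>cube k N. if is = f p then \<Prod>l<k. (gs ! l) $$ (js ! l, is ! l) else 0)"
    by (rule sum.swap)
  also have "\<dots> = (\<Sum>p\<in>P. \<Prod>l<k. (gs ! l) $$ (js ! l, f p ! l))"
    using assms(2) by (intro sum.cong refl) simp
  finally show ?thesis .
qed

lemma square_index_less: "a < n \<Longrightarrow> b < n \<Longrightarrow> a * n + b < n\<^sup>2" for a b n :: nat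
proof -
  assume "a < n" "b < n"
  then have "a * n + b < Suc a * n" by simp
  also have "\<dots> \<le> n * n" using \<open>a < n\<close> by (intro mult_le_mono1) simp
  finally show ?thesis by (simp add: power2_eq_square)
qed

lemma local_action_iterated_matmul:
  assumes "js \<in> cube k (n\<^sup>2)" "0 < k"
  shows "local_action (replicate k (n\<^sup>2)) gs (iterated_matmul_tensor k n) js =
    (\<Sum>ps\<in>cube k n. \<Prod>l<k. (gs ! l) $$ (js ! l, ps ! l * n + ps ! (Suc l mod k)))"
proof -
  let ?h = "\<lambda>ps l. ps ! l * n + ps ! (Suc l mod k)"
  have h: "?h ps l < n\<^sup>2" if "ps \<in> cube k n" "l < k" for ps l
    using that assms(2) by (intro square_index_less) (auto simp: cube_def)
  have "local_action (replicate k (n\<^sup>2)) gs (iterated_matmul_tensor k n) js =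
      (\<Sum>ps\<in>cube k n. \<Prod>l<k. (gs ! l) $$ (js ! l, map (?h ps) [0..<k] ! l))"
  proof (rule local_action_sum_basis)
    show "map (?h ps) [0..<k] \<in> cube k (n\<^sup>2)" if "ps \<in> cube k n" for ps
      using h[OF that] by (simp add: cube_def)
    show "iterated_matmul_tensor k n is = (\<Sum>ps\<in>cube k n. if is = map (?h ps) [0..<k] then 1 else 0)" for "is"
      unfolding iterated_matmul_tensor_def set_multi_indices_replicate matrix_unit_vec_def
      by (intro sum.cong refl tensor_product_unit_vecs h)
  qed (use assms in auto)
  then show ?thesis by simp
qed

text \<open>The slice in direction \<open>x\<close>, restricted to the first \<open>m\<close>
  coordinates of factor 1, has \<open>t\<close> in its kernel. Both vectors have norm 1, rather than
  being merely nonzero, to keep the witnesses in a compact set.\<close>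

definition has_singular_slice :: "nat \<Rightarrow> nat \<Rightarrow> nat \<Rightarrow> tensor \<Rightarrow> bool" where
  "has_singular_slice k N m S \<longleftrightarrow> (\<exists>x t. (\<Sum>i<2. (cmod (x i))\<^sup>2) = 1 \<and> (\<Sum>j<m. (cmod (t j))\<^sup>2) = 1 \<and>
     (\<forall>rs\<in>cube (k - 2) N. (\<Sum>i<2. \<Sum>j<m. x i * t j * S (i # j # rs)) = 0))"

text \<open>Among the summation indices of matrix multiplication, \<open>ps ! 1\<close> occurs in
  the first two factors only. Summing over it multiplies the two contracted matrices, and
  \<open>pencil_annihilator\<close> makes this product vanish whatever the other factors
  are.\<close>

lemma matrix_orbit_matmul_has_singular_slice:
  assumes k: "3 \<le> k" and n: "2 \<le> n" and m: "(n - 1) * n < m" "m \<le> n\<^sup>2"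
    and S: "S \<in> matrix_orbit k (n\<^sup>2) (iterated_matmul_tensor k n)"
  shows "has_singular_slice k (n\<^sup>2) m S"
proof -
  obtain gs where gs: "S = local_action (replicate k (n\<^sup>2)) gs (iterated_matmul_tensor k n)"
    using S unfolding matrix_orbit_def by auto
  let ?X = "\<lambda>i p q. (gs ! 0) $$ (i, p * n + q)" and ?W = "\<lambda>j q r. (gs ! 1) $$ (j, q * n + r)"
  obtain x t where xt: "(\<Sum>i<2. (cmod (x i))\<^sup>2) = 1" "(\<Sum>j<m. (cmod (t j))\<^sup>2) = 1"
    "\<forall>p<n. \<forall>r<n. (\<Sum>q<n. (\<Sum>i<2. x i * ?X i p q) * (\<Sum>j<m. t j * ?W j q r)) = 0"
    by (rule pencil_annihilator[of n m ?X ?W]) (use n m in auto)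
  have "(\<Sum>i<2. \<Sum>j<m. x i * t j * S (i # j # rs)) = 0" if rs: "rs \<in> cube (k - 2) (n\<^sup>2)" for rs
  proof -
    let ?G = "\<lambda>ps. \<Prod>l\<in>{2..<k}. (gs ! l) $$ (rs ! (l - 2), ps ! l * n + ps ! (Suc l mod k))"
    let ?x = "\<lambda>p q. \<Sum>i<2. x i * ?X i p q" and ?t = "\<lambda>q r. \<Sum>j<m. t j * ?W j q r"
    have split: "{..<k} = insert 0 (insert 1 {2..<k})" using k by auto
    have S_eq: "S (i # j # rs) = (\<Sum>ps\<in>cube k n. ?X i (ps ! 0) (ps ! 1) * ?W j (ps ! 1) (ps ! 2) * ?G ps)"
      if "i < 2" "j < m" for i j
    proof -
      have "2 \<le> n\<^sup>2" using n by (metis le_trans self_le_power pos2 zero_less_numeral less_le_trans one_le_numeral)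
      then have "i # j # rs \<in> cube k (n\<^sup>2)"
        using that m rs k by (auto simp: cube_def nth_Cons' less_diff_conv)
      then have "S (i # j # rs) = (\<Sum>ps\<in>cube k n. \<Prod>l<k. (gs ! l) $$ ((i # j # rs) ! l, ps ! l * n + ps ! (Suc l mod k)))"
        unfolding gs using k by (intro local_action_iterated_matmul) auto
      also have "\<dots> = (\<Sum>ps\<in>cube k n. ?X i (ps ! 0) (ps ! 1) * ?W j (ps ! 1) (ps ! 2) * ?G ps)"
      proof (rule sum.cong[OF refl])
        fix ps :: "nat list"
        have "(\<Prod>l\<in>{2..<k}. (gs ! l) $$ ((i # j # rs) ! l, ps ! l * n + ps ! (Suc l mod k))) = ?G ps"
          by (intro prod.cong refl) (auto simp: nth_Cons' numeral_2_eq_2)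
        then show "(\<Prod>l<k. (gs ! l) $$ ((i # j # rs) ! l, ps ! l * n + ps ! (Suc l mod k))) =
            ?X i (ps ! 0) (ps ! 1) * ?W j (ps ! 1) (ps ! 2) * ?G ps"
          unfolding split using k by (simp add: numeral_2_eq_2 mult.assoc)
      qed
      finally show ?thesis .
    qed
    have "(\<Sum>i<2. \<Sum>j<m. x i * t j * S (i # j # rs)) =
        (\<Sum>i<2. \<Sum>j<m. \<Sum>ps\<in>cube k n. (x i * ?X i (ps ! 0) (ps ! 1)) * (t j * ?W j (ps ! 1) (ps ! 2)) * ?G ps)"
      by (intro sum.cong refl) (simp add: S_eq sum_distrib_left mult_ac)
    also have "\<dots> = (\<Sum>ps\<in>cube k n. ?x (ps ! 0) (ps ! 1) * ?t (ps ! 1) (ps ! 2) * ?G ps)"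
    proof -
      have "(\<Sum>ps\<in>cube k n. ?x (ps ! 0) (ps ! 1) * ?t (ps ! 1) (ps ! 2) * ?G ps) =
          (\<Sum>ps\<in>cube k n. \<Sum>i<2. \<Sum>j<m. (x i * ?X i (ps ! 0) (ps ! 1)) * (t j * ?W j (ps ! 1) (ps ! 2)) * ?G ps)"
        by (simp only: sum_product) (simp only: sum_distrib_right)
      also have "\<dots> = (\<Sum>i<2. \<Sum>ps\<in>cube k n. \<Sum>j<m. (x i * ?X i (ps ! 0) (ps ! 1)) * (t j * ?W j (ps ! 1) (ps ! 2)) * ?G ps)"
        by (rule sum.swap)
      also have "\<dots> = (\<Sum>i<2. \<Sum>j<m. \<Sum>ps\<in>cube k n. (x i * ?X i (ps ! 0) (ps ! 1)) * (t j * ?W j (ps ! 1) (ps ! 2)) * ?G ps)"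
        by (intro sum.cong refl sum.swap)
      finally show ?thesis ..
    qed
    also have "\<dots> = (\<Sum>ps\<in>{ps \<in> cube k n. ps ! 1 = 0}. \<Sum>q<n. ?x (ps[1 := q] ! 0) (ps[1 := q] ! 1) *
        ?t (ps[1 := q] ! 1) (ps[1 := q] ! 2) * ?G (ps[1 := q]))"
      by (rule sum_cube_slice[OF order_refl]) (use k cube_update in auto)
    also have "\<dots> = (\<Sum>ps\<in>{ps \<in> cube k n. ps ! 1 = 0}. \<Sum>q<n. ?x (ps ! 0) q * ?t q (ps ! 2) * ?G ps)"
    proof (rule sum.cong[OF refl], rule sum.cong[OF refl])
      fix ps q assume ps: "ps \<in> {ps \<in> cube k n. ps ! 1 = 0}"
      then have len: "length ps = k" by (simp add: cube_def)
      have "?G (ps[1 := q]) = ?G ps"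
      proof (rule prod.cong[OF refl])
        fix l assume l: "l \<in> {2..<k}"
        \<comment> \<open>For \<open>l\<close> at least 2 the cyclic successor may wrap around to 0
          but is never 1, so the later factors do not see \<open>q\<close>.\<close>
        have "Suc l mod k \<noteq> 1" using l by (cases "Suc l = k") auto
        then show "(gs ! l) $$ (rs ! (l - 2), ps[1 := q] ! l * n + ps[1 := q] ! (Suc l mod k)) =
            (gs ! l) $$ (rs ! (l - 2), ps ! l * n + ps ! (Suc l mod k))"
          using l by simp
      qed
      then show "?x (ps[1 := q] ! 0) (ps[1 := q] ! 1) * ?t (ps[1 := q] ! 1) (ps[1 := q] ! 2) * ?G (ps[1 := q]) =
          ?x (ps ! 0) q * ?t q (ps ! 2) * ?G ps"
        using len k by simp
    qed
    also have "\<dots> = (\<Sum>ps\<in>{ps \<in> cube k n. ps ! 1 = 0}. (\<Sum>q<n. ?x (ps ! 0) q * ?t q (ps ! 2)) * ?G ps)"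
      by (simp only: sum_distrib_right)
    also have "\<dots> = 0"
    proof (rule sum.neutral, rule ballI)
      fix ps assume "ps \<in> {ps \<in> cube k n. ps ! 1 = 0}"
      then have "ps ! 0 < n" "ps ! 2 < n" using k by (auto simp: cube_def)
      then have "(\<Sum>q<n. ?x (ps ! 0) q * ?t q (ps ! 2)) = 0" using xt(3) by blast
      then show "(\<Sum>q<n. ?x (ps ! 0) q * ?t q (ps ! 2)) * ?G ps = 0" by simp
    qed
    finally show ?thesis .
  qed
  then show ?thesis unfolding has_singular_slice_def using xt(1,2) by blast
qed

text \<open>The equations are jointly continuous in witness and tensor, so this set is the
  projection of a closed set along a product of two compact spheres.\<close>

lemma closed_has_singular_slice: "closed {S. has_singular_slice k N m S}"
proof -
  let ?K = "\<lambda>m. {x :: nat \<Rightarrow> complex. (\<forall>i. i \<ge> m \<longrightarrow> x i = 0) \<and> (\<Sum>i<m. (cmod (x i))\<^sup>2) = 1}"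
  define C where "C = {z :: ((nat \<Rightarrow> complex) \<times> (nat \<Rightarrow> complex)) \<times> tensor. \<forall>rs\<in>cube (k - 2) N.
    (\<Sum>i<2. \<Sum>j<m. fst (fst z) i * snd (fst z) j * snd z (i # j # rs)) = 0}"
  have "C = (\<Inter>rs\<in>cube (k - 2) N. {z. (\<Sum>i<2. \<Sum>j<m. fst (fst z) i * snd (fst z) j * snd z (i # j # rs)) = 0})"
    unfolding C_def by auto
  also have "closed \<dots>"
    by (intro closed_INT ballI closed_Collect_eq continuous_intros continuous_on_product_coordinates[THEN continuous_on_compose2]) auto
  finally have "closed C" .
  then have "closed {S. \<exists>z\<in>?K 2 \<times> ?K m. (z, S) \<in> C}"
    by (intro closed_Bex_compact compact_Times compact_unit_vectors)
  moreover have "{S. has_singular_slice k N m S} = {S. \<exists>z\<in>?K 2 \<times> ?K m. (z, S) \<in> C}"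
  proof (intro Collect_cong iffI)
    fix S :: tensor assume "has_singular_slice k N m S"
    then obtain x t where xt: "(\<Sum>i<2. (cmod (x i))\<^sup>2) = 1" "(\<Sum>j<m. (cmod (t j))\<^sup>2) = 1"
      "\<forall>rs\<in>cube (k - 2) N. (\<Sum>i<2. \<Sum>j<m. x i * t j * S (i # j # rs)) = 0"
      unfolding has_singular_slice_def by auto
    \<comment> \<open>Only finitely many values of the witnesses matter; truncation by 0 moves them
      into the compact sets.\<close>
    let ?z = "(\<lambda>i. if i < 2 then x i else 0, \<lambda>j. if j < m then t j else 0)"
    show "\<exists>z\<in>?K 2 \<times> ?K m. (z, S) \<in> C"
      using xt by (intro bexI[of _ ?z]) (auto simp: C_def)
  next
    fix S :: tensor assume "\<exists>z\<in>?K 2 \<times> ?K m. (z, S) \<in> C"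
    then show "has_singular_slice k N m S"
      unfolding has_singular_slice_def C_def by auto
  qed
  ultimately show ?thesis by simp
qed

lemma closure_matmul_has_singular_slice:
  assumes "3 \<le> k" "2 \<le> n" "(n - 1) * n < m" "m \<le> n\<^sup>2"
    "S \<in> closure (matrix_orbit k (n\<^sup>2) (iterated_matmul_tensor k n))"
  shows "has_singular_slice k (n\<^sup>2) m S"
proof -
  have "matrix_orbit k (n\<^sup>2) (iterated_matmul_tensor k n) \<subseteq> {S. has_singular_slice k (n\<^sup>2) m S}"
    using matrix_orbit_matmul_has_singular_slice[OF assms(1-4)] by (intro subsetI CollectI)
  then have "closure (matrix_orbit k (n\<^sup>2) (iterated_matmul_tensor k n)) \<subseteq> {S. has_singular_slice k (n\<^sup>2) m S}"
    using closed_has_singular_slice by (rule closure_minimal)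
  then show ?thesis using assms(5) by (auto dest: subsetD)
qed

section \<open>Tensors with uniform marginals\<close>


text \<open>Pythagoras for the pairwise orthogonal vectors \<open>f _ j\<close> of squared norm
  \<open>g j\<close>; a diagonal marginal provides exactly such vectors.\<close>

lemma sum_norm_square_orthogonal:
  fixes f :: "'p \<Rightarrow> nat \<Rightarrow> complex"
  assumes "finite J"
    "\<And>j j'. j \<in> J \<Longrightarrow> j' \<in> J \<Longrightarrow> (\<Sum>p\<in>P. cnj (f p j) * f p j') = (if j = j' then complex_of_real (g j) else 0)"
  shows "(\<Sum>p\<in>P. (cmod (\<Sum>j\<in>J. t j * f p j))\<^sup>2) = (\<Sum>j\<in>J. (cmod (t j))\<^sup>2 * g j)"
proof -
  have "complex_of_real (\<Sum>p\<in>P. (cmod (\<Sum>j\<in>J. t j * f p j))\<^sup>2) =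
      (\<Sum>p\<in>P. (\<Sum>j'\<in>J. t j' * f p j') * cnj (\<Sum>j\<in>J. t j * f p j))"
    unfolding of_real_sum complex_norm_square ..
  also have "\<dots> = (\<Sum>p\<in>P. \<Sum>j'\<in>J. \<Sum>j\<in>J. t j' * cnj (t j) * (cnj (f p j) * f p j'))"
    unfolding cnj_sum sum_product by (intro sum.cong refl) simp
  also have "\<dots> = (\<Sum>j'\<in>J. \<Sum>p\<in>P. \<Sum>j\<in>J. t j' * cnj (t j) * (cnj (f p j) * f p j'))"
    by (rule sum.swap)
  also have "\<dots> = (\<Sum>j'\<in>J. \<Sum>j\<in>J. \<Sum>p\<in>P. t j' * cnj (t j) * (cnj (f p j) * f p j'))"
    by (intro sum.cong refl sum.swap)
  also have "\<dots> = (\<Sum>j'\<in>J. \<Sum>j\<in>J. if j = j' then t j' * cnj (t j) * complex_of_real (g j) else 0)"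
    unfolding sum_distrib_left[symmetric] by (intro sum.cong refl) (simp add: assms(2))
  also have "\<dots> = (\<Sum>j\<in>J. t j * cnj (t j) * complex_of_real (g j))"
    using assms(1) by (intro sum.cong refl) simp
  also have "\<dots> = complex_of_real (\<Sum>j\<in>J. (cmod (t j))\<^sup>2 * g j)"
    unfolding of_real_sum of_real_mult complex_norm_square ..
  finally show ?thesis by (rule of_real_eq_iff[THEN iffD1])
qed

lemma sum_norm_Cauchy_Schwarz:
  fixes u v :: "'p \<Rightarrow> complex"
  shows "(cmod (\<Sum>p\<in>P. u p * v p))\<^sup>2 \<le> (\<Sum>p\<in>P. (cmod (u p))\<^sup>2) * (\<Sum>p\<in>P. (cmod (v p))\<^sup>2)"
proof -
  have "cmod (\<Sum>p\<in>P. u p * v p) \<le> (\<Sum>p\<in>P. \<bar>cmod (u p)\<bar> * \<bar>cmod (v p)\<bar>)"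
    by (rule order_trans[OF norm_sum]) (simp add: norm_mult)
  also have "\<dots> \<le> L2_set (\<lambda>p. cmod (u p)) P * L2_set (\<lambda>p. cmod (v p)) P"
    by (rule L2_set_mult_ineq)
  finally have "(cmod (\<Sum>p\<in>P. u p * v p))\<^sup>2 \<le> (L2_set (\<lambda>p. cmod (u p)) P * L2_set (\<lambda>p. cmod (v p)) P)\<^sup>2"
    by (intro power_mono) auto
  then show ?thesis by (simp add: power_mult_distrib L2_set_def sum_nonneg)
qed

text \<open>A marginal of rank 1 in sorted diagonal form pins its index to 0. This happens from the
  fourth factor on and leaves three free indices.\<close>

definition three_index :: "nat \<Rightarrow> nat \<Rightarrow> nat \<Rightarrow> nat \<Rightarrow> nat list" where
  "three_index k i j l = i # j # l # replicate (k - 3) 0"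

lemma nth_three_index:
  assumes "3 \<le> k" "q < k"
  shows "three_index k i j l ! q = (if q = 0 then i else if q = 1 then j else if q = 2 then l else 0)"
  using assms by (auto simp: three_index_def nth_Cons' numeral_2_eq_2)

lemma length_three_index: "3 \<le> k \<Longrightarrow> length (three_index k i j l) = k"
  by (simp add: three_index_def)

lemma three_index_in_cube:
  assumes "3 \<le> k" "i < N" "j < N" "l < N"
  shows "three_index k i j l \<in> cube k N"
  using assms nth_three_index[OF assms(1)] by (simp add: cube_def length_three_index)

lemma eq_three_indexI:
  assumes "3 \<le> k" "length js = k" "\<And>q. 3 \<le> q \<Longrightarrow> q < k \<Longrightarrow> js ! q = 0"
  shows "js = three_index k (js ! 0) (js ! 1) (js ! 2)"
proof (rule nth_equalityI)
  fix q assume "q < length js"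
  then have q: "q < k" using assms by simp
  consider "q = 0" | "q = 1" | "q = 2" | "3 \<le> q" by linarith
  then show "js ! q = three_index k (js ! 0) (js ! 1) (js ! 2) ! q"
    unfolding nth_three_index[OF assms(1) q] by cases (simp_all add: assms(3)[OF _ q])
qed (simp add: assms length_three_index)

text \<open>Updating index 1 or 2 leaves untouched all positions constrained by the support
  condition, so only two free indices survive in the sum.\<close>

lemma gram_three_index:
  assumes k: "3 \<le> k" and N: "2 \<le> N"
    and supp: "\<And>js. js \<in> cube k N \<Longrightarrow> S js \<noteq> 0 \<Longrightarrow> js ! 0 < 2 \<and> (\<forall>q. 3 \<le> q \<longrightarrow> q < k \<longrightarrow> js ! q = 0)"
    and ab: "a < N" "b < N"
  shows "gram k N 1 S a b = (\<Sum>(i, l)\<in>{..<2} \<times> {..<N}. cnj (S (three_index k i a l)) * S (three_index k i b l))"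
    and "gram k N 2 S a b = (\<Sum>(i, j)\<in>{..<2} \<times> {..<N}. cnj (S (three_index k i j a)) * S (three_index k i j b))"
proof -
  have supp': "js ! 0 < 2 \<and> (\<forall>q. 3 \<le> q \<longrightarrow> q < k \<longrightarrow> js ! q = 0)"
    if "js \<in> cube k N" "S (js[p := a]) \<noteq> 0" "p = 1 \<or> p = 2" for js p
    using supp[OF cube_update[OF that(1) ab(1)] that(2)] that(3) by auto
  have "gram k N 1 S a b = (\<Sum>js\<in>(\<lambda>(i, l). three_index k i 0 l) ` ({..<2} \<times> {..<N}). cnj (S (js[1 := a])) * S (js[1 := b]))"
    unfolding gram_def
  proof (rule sum.mono_neutral_right)
    show "(\<lambda>(i, l). three_index k i 0 l) ` ({..<2} \<times> {..<N}) \<subseteq> {js \<in> cube k N. js ! 1 = 0}"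
      using k N by (auto intro!: three_index_in_cube simp: nth_three_index)
    show "\<forall>js\<in>{js \<in> cube k N. js ! 1 = 0} - (\<lambda>(i, l). three_index k i 0 l) ` ({..<2} \<times> {..<N}).
        cnj (S (js[1 := a])) * S (js[1 := b]) = 0"
    proof (rule ballI, rule ccontr)
      fix js assume js: "js \<in> {js \<in> cube k N. js ! 1 = 0} - (\<lambda>(i, l). three_index k i 0 l) ` ({..<2} \<times> {..<N})"
        and "cnj (S (js[1 := a])) * S (js[1 := b]) \<noteq> 0"
      then have s: "js ! 0 < 2 \<and> (\<forall>q. 3 \<le> q \<longrightarrow> q < k \<longrightarrow> js ! q = 0)" by (intro supp'[of js 1]) auto
      have c: "length js = k" "js ! 1 = 0" "js ! 2 < N" using js k by (auto simp: cube_def)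
      then have "js = three_index k (js ! 0) 0 (js ! 2)" using eq_three_indexI[OF k c(1)] s by simp
      then have "js \<in> (\<lambda>(i, l). three_index k i 0 l) ` ({..<2} \<times> {..<N})"
        using s c(3) by (intro image_eqI[of _ _ "(js ! 0, js ! 2)"]) auto
      then show False using js by blast
    qed
  qed simp
  also have "\<dots> = (\<Sum>(i, l)\<in>{..<2} \<times> {..<N}. cnj (S (three_index k i a l)) * S (three_index k i b l))"
    by (subst sum.reindex) (auto simp: inj_on_def three_index_def intro!: sum.cong)
  finally show "gram k N 1 S a b = (\<Sum>(i, l)\<in>{..<2} \<times> {..<N}. cnj (S (three_index k i a l)) * S (three_index k i b l))" .
  have "gram k N 2 S a b = (\<Sum>js\<in>(\<lambda>(i, j). three_index k i j 0) ` ({..<2} \<times> {..<N}). cnj (S (js[2 := a])) * S (js[2 := b]))"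
    unfolding gram_def
  proof (rule sum.mono_neutral_right)
    show "(\<lambda>(i, j). three_index k i j 0) ` ({..<2} \<times> {..<N}) \<subseteq> {js \<in> cube k N. js ! 2 = 0}"
      using k N by (auto intro!: three_index_in_cube simp: nth_three_index)
    show "\<forall>js\<in>{js \<in> cube k N. js ! 2 = 0} - (\<lambda>(i, j). three_index k i j 0) ` ({..<2} \<times> {..<N}).
        cnj (S (js[2 := a])) * S (js[2 := b]) = 0"
    proof (rule ballI, rule ccontr)
      fix js assume js: "js \<in> {js \<in> cube k N. js ! 2 = 0} - (\<lambda>(i, j). three_index k i j 0) ` ({..<2} \<times> {..<N})"
        and "cnj (S (js[2 := a])) * S (js[2 := b]) \<noteq> 0"
      then have s: "js ! 0 < 2 \<and> (\<forall>q. 3 \<le> q \<longrightarrow> q < k \<longrightarrow> js ! q = 0)" by (intro supp'[of js 2]) auto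
      have c: "length js = k" "js ! 2 = 0" "js ! 1 < N" using js k by (auto simp: cube_def)
      then have "js = three_index k (js ! 0) (js ! 1) 0" using eq_three_indexI[OF k c(1)] s by simp
      then have "js \<in> (\<lambda>(i, j). three_index k i j 0) ` ({..<2} \<times> {..<N})"
        using s c(3) by (intro image_eqI[of _ _ "(js ! 0, js ! 1)"]) auto
      then show False using js by blast
    qed
  qed simp
  also have "\<dots> = (\<Sum>(i, j)\<in>{..<2} \<times> {..<N}. cnj (S (three_index k i j a)) * S (three_index k i j b))"
    by (subst sum.reindex) (auto simp: inj_on_def three_index_def numeral_2_eq_2 intro!: sum.cong)
  finally show "gram k N 2 S a b = (\<Sum>(i, j)\<in>{..<2} \<times> {..<N}. cnj (S (three_index k i j a)) * S (three_index k i j b))" .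
qed

text \<open>
  A slice singular in the direction \<open>x\<close> would make the contraction of \<open>R\<close> with \<open>t\<close> a product
  vector \<open>y \<otimes> z\<close> of squared norm \<open>\<nu> / m\<close>, too large for the third marginal.
\<close>

lemma uniform_marginals_no_singular_slice:
  assumes k: "3 \<le> k" and N: "2 \<le> N" and m: "0 < m" "m \<le> N" "m < c" and \<nu>: "0 < \<nu>"
    and gram0: "\<And>a. 2 \<le> a \<Longrightarrow> a < N \<Longrightarrow> gram k N 0 R a a = 0"
    and gram3: "\<And>q a. 3 \<le> q \<Longrightarrow> q < k \<Longrightarrow> 1 \<le> a \<Longrightarrow> a < N \<Longrightarrow> gram k N q R a a = 0"
    and gram1: "\<And>a b. a < m \<Longrightarrow> b < m \<Longrightarrow> gram k N 1 R a b = (if a = b then complex_of_real (\<nu> / m) else 0)"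
    and gram2: "\<And>a b. a < N \<Longrightarrow> b < N \<Longrightarrow> gram k N 2 R a b = (if a = b then complex_of_real (d a) else 0)"
    and d: "\<And>a. a < N \<Longrightarrow> d a \<le> \<nu> / real c"
  shows "\<not> has_singular_slice k N m R"
proof
  assume "has_singular_slice k N m R"
  then obtain x t where x: "(\<Sum>i<2. (cmod (x i))\<^sup>2) = 1" and t: "(\<Sum>j<m. (cmod (t j))\<^sup>2) = 1"
    and xt: "\<forall>rs\<in>cube (k - 2) N. (\<Sum>i<2. \<Sum>j<m. x i * t j * R (i # j # rs)) = 0"
    unfolding has_singular_slice_def by auto
  have supp: "js ! 0 < 2 \<and> (\<forall>q. 3 \<le> q \<longrightarrow> q < k \<longrightarrow> js ! q = 0)" if js: "js \<in> cube k N" "R js \<noteq> 0" for js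
  proof (intro conjI allI impI)
    show "js ! 0 < 2"
      using gram_diagonal_zero_imp[OF gram0 js(1) refl] js k by (force simp: cube_def)
    fix q assume q: "3 \<le> q" "q < k"
    then have "js ! q < N" using js by (simp add: cube_def)
    then have "\<not> 1 \<le> js ! q" using gram_diagonal_zero_imp[OF gram3[OF q] js(1) refl q(2)] js(2) by blast
    then show "js ! q = 0" by simp
  qed
  define s where "s i j l = R (three_index k i j l)" for i j l
  define B where "B i l = (\<Sum>j<m. t j * s i j l)" for i l
  \<comment> \<open>The matrix \<open>B\<close> is the contraction of \<open>R\<close> with
    \<open>t\<close>. As x^T B = 0, every column of \<open>B\<close> is a multiple of the unit
    vector (- x 1, x 0); \<open>z\<close> collects the multipliers, and \<open>y\<close>, the
    conjugate of that vector, recovers \<open>z\<close> from \<open>B\<close>.\<close>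
  define z where "z l = cnj (x 0) * B 1 l - cnj (x 1) * B 0 l" for l
  define y where "y i = (if i = 0 then - cnj (x 1) else cnj (x 0))" for i :: nat
  define Z where "Z = (\<Sum>l<N. (cmod (z l))\<^sup>2)"
  have x1: "cnj (x 0) * x 0 + cnj (x 1) * x 1 = 1"
  proof -
    have "complex_of_real ((cmod (x 0))\<^sup>2 + (cmod (x 1))\<^sup>2) = 1" using x by (simp add: numeral_2_eq_2)
    then show ?thesis by (simp only: of_real_add complex_norm_square mult.commute)
  qed
  have rel: "x 0 * B 0 l + x 1 * B 1 l = 0" if "l < N" for l
  proof -
    have "l # replicate (k - 3) 0 \<in> cube (k - 2) N"
      using that k N by (auto simp: cube_def nth_Cons')
    from bspec[OF xt this] have "(\<Sum>i<2. \<Sum>j<m. x i * t j * s i j l) = 0"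
      by (simp add: s_def three_index_def)
    moreover have "(\<Sum>i<2. \<Sum>j<m. x i * t j * s i j l) = (\<Sum>i<2. x i * B i l)"
      by (simp add: B_def sum_distrib_left mult.assoc)
    ultimately show ?thesis by (simp add: numeral_2_eq_2)
  qed
  have B1: "B 1 l = x 0 * z l" and B0: "B 0 l = - x 1 * z l" if "l < N" for l
  proof -
    have e: "x 0 * B 0 l = - (x 1 * B 1 l)" using rel[OF that] by (simp add: eq_neg_iff_add_eq_0)
    have "x 0 * z l = cnj (x 0) * x 0 * B 1 l - cnj (x 1) * (x 0 * B 0 l)"
      unfolding z_def by (simp add: algebra_simps)
    also have "\<dots> = (cnj (x 0) * x 0 + cnj (x 1) * x 1) * B 1 l"
      unfolding e by (simp add: algebra_simps)
    finally show "B 1 l = x 0 * z l" using x1 by simp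
    have "- x 1 * z l = cnj (x 1) * x 1 * B 0 l - cnj (x 0) * (x 1 * B 1 l)"
      unfolding z_def by (simp add: algebra_simps)
    also have "x 1 * B 1 l = - (x 0 * B 0 l)" using e by simp
    also have "cnj (x 1) * x 1 * B 0 l - cnj (x 0) * (- (x 0 * B 0 l)) = (cnj (x 0) * x 0 + cnj (x 1) * x 1) * B 0 l"
      by (simp add: algebra_simps)
    finally show "B 0 l = - x 1 * z l" using x1 by simp
  qed
  \<comment> \<open>By the second marginal, the vectors combined by \<open>t\<close> are orthogonal
    of squared norm \<nu> / m. This evaluates the norm of \<open>B\<close>, which is also that of
    \<open>z\<close>.\<close>
  have "(\<Sum>p\<in>{..<2} \<times> {..<N}. (cmod (\<Sum>j\<in>{..<m}. t j * (case p of (i, l) \<Rightarrow> s i j l)))\<^sup>2) = (\<Sum>j<m. (cmod (t j))\<^sup>2 * (\<nu> / m))"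
  proof (rule sum_norm_square_orthogonal)
    fix a b assume ab: "a \<in> {..<m}" "b \<in> {..<m}"
    then have "gram k N 1 R a b = (\<Sum>(i, l)\<in>{..<2} \<times> {..<N}. cnj (s i a l) * s i b l)"
      unfolding s_def using m by (intro gram_three_index[OF k N supp]) auto
    then show "(\<Sum>p\<in>{..<2} \<times> {..<N}. cnj (case p of (i, l) \<Rightarrow> s i a l) * (case p of (i, l) \<Rightarrow> s i b l)) =
        (if a = b then complex_of_real (\<nu> / m) else 0)"
      using gram1[of a b] ab by (simp add: case_prod_beta)
  qed simp
  moreover have "(\<Sum>p\<in>{..<2} \<times> {..<N}. (cmod (\<Sum>j\<in>{..<m}. t j * (case p of (i, l) \<Rightarrow> s i j l)))\<^sup>2) =
      (\<Sum>i<2. \<Sum>l<N. (cmod (B i l))\<^sup>2)"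
    unfolding sum.cartesian_product B_def by (intro sum.cong refl) auto
  moreover have "(\<Sum>i<2. \<Sum>l<N. (cmod (B i l))\<^sup>2) = Z"
  proof -
    have "(\<Sum>i<2. \<Sum>l<N. (cmod (B i l))\<^sup>2) = (\<Sum>l<N. (cmod (B 0 l))\<^sup>2) + (\<Sum>l<N. (cmod (B 1 l))\<^sup>2)"
      by (simp add: numeral_2_eq_2)
    also have "\<dots> = (\<Sum>l<N. (cmod (x 1))\<^sup>2 * (cmod (z l))\<^sup>2) + (\<Sum>l<N. (cmod (x 0))\<^sup>2 * (cmod (z l))\<^sup>2)"
      by (intro arg_cong2[where f = "(+)"] sum.cong refl) (simp_all add: B0 B1[simplified] norm_mult power_mult_distrib)
    also have "\<dots> = ((cmod (x 0))\<^sup>2 + (cmod (x 1))\<^sup>2) * Z"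
      by (simp add: Z_def sum_distrib_left algebra_simps)
    finally show ?thesis using x by (simp add: numeral_2_eq_2)
  qed
  ultimately have "Z = (\<Sum>j<m. (cmod (t j))\<^sup>2) * (\<nu> / m)" unfolding sum_distrib_right by (simp only:)
  then have Z: "Z = \<nu> / m" unfolding t by simp
  \<comment> \<open>Now the third factor is contracted instead, against the conjugate of
    \<open>z\<close>; the third marginal bounds the result.\<close>
  define C where "C p = (\<Sum>l\<in>{..<N}. cnj (z l) * (case p of (i, j) \<Rightarrow> s i j l))" for p
  have "(\<Sum>p\<in>{..<2} \<times> {..<N}. (cmod (C p))\<^sup>2) = (\<Sum>l<N. (cmod (cnj (z l)))\<^sup>2 * d l)"
    unfolding C_def
  proof (rule sum_norm_square_orthogonal)
    fix a b assume ab: "a \<in> {..<N}" "b \<in> {..<N}"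
    then have "gram k N 2 R a b = (\<Sum>(i, j)\<in>{..<2} \<times> {..<N}. cnj (s i j a) * s i j b)"
      unfolding s_def by (intro gram_three_index[OF k N supp]) auto
    then show "(\<Sum>p\<in>{..<2} \<times> {..<N}. cnj (case p of (i, j) \<Rightarrow> s i j a) * (case p of (i, j) \<Rightarrow> s i j b)) =
        (if a = b then complex_of_real (d a) else 0)"
      using gram2[of a b] ab by (simp add: case_prod_beta)
  qed simp
  also have "\<dots> \<le> (\<Sum>l<N. (cmod (z l))\<^sup>2 * (\<nu> / c))"
    unfolding complex_mod_cnj by (intro sum_mono mult_left_mono d) auto
  also have "\<dots> = Z * (\<nu> / c)" unfolding Z_def sum_distrib_right ..
  finally have C_le: "(\<Sum>p\<in>{..<2} \<times> {..<N}. (cmod (C p))\<^sup>2) \<le> Z * (\<nu> / c)" .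
  \<comment> \<open>Pairing \<open>C\<close> with the product of the unit vectors \<open>y\<close>
    and \<open>t\<close> returns the squared norm of \<open>z\<close>, so Cauchy-Schwarz bounds Z^2
    by Z \<nu> / c.\<close>
  have "complex_of_real Z = (\<Sum>l<N. cnj (z l) * z l)"
    unfolding Z_def of_real_sum complex_norm_square by (simp add: mult.commute)
  also have "\<dots> = (\<Sum>l<N. \<Sum>(i, j)\<in>{..<2} \<times> {..<m}. (y i * t j) * (cnj (z l) * s i j l))"
  proof (intro sum.cong refl)
    fix l
    have "z l = (\<Sum>i<2. y i * B i l)" by (simp add: z_def y_def numeral_2_eq_2)
    also have "\<dots> = (\<Sum>(i, j)\<in>{..<2} \<times> {..<m}. (y i * t j) * s i j l)"
      unfolding B_def by (simp add: sum_distrib_left sum.cartesian_product mult.assoc)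
    finally have "cnj (z l) * z l = cnj (z l) * (\<Sum>(i, j)\<in>{..<2} \<times> {..<m}. (y i * t j) * s i j l)" by simp
    also have "\<dots> = (\<Sum>(i, j)\<in>{..<2} \<times> {..<m}. (y i * t j) * (cnj (z l) * s i j l))"
      unfolding sum_distrib_left by (intro sum.cong refl) (auto simp: mult_ac)
    finally show "cnj (z l) * z l = (\<Sum>(i, j)\<in>{..<2} \<times> {..<m}. (y i * t j) * (cnj (z l) * s i j l))" .
  qed
  also have "\<dots> = (\<Sum>p\<in>{..<2} \<times> {..<m}. (case p of (i, j) \<Rightarrow> y i * t j) * C p)"
    unfolding C_def by (subst sum.swap) (auto simp: sum_distrib_left intro!: sum.cong)
  finally have "Z\<^sup>2 = (cmod (\<Sum>p\<in>{..<2} \<times> {..<m}. (case p of (i, j) \<Rightarrow> y i * t j) * C p))\<^sup>2"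
    by (metis norm_of_real power2_abs)
  also have "\<dots> \<le> (\<Sum>p\<in>{..<2} \<times> {..<m}. (cmod (case p of (i, j) \<Rightarrow> y i * t j))\<^sup>2) * (\<Sum>p\<in>{..<2} \<times> {..<m}. (cmod (C p))\<^sup>2)"
    by (rule sum_norm_Cauchy_Schwarz)
  also have "(\<Sum>p\<in>{..<2} \<times> {..<m}. (cmod (case p of (i, j) \<Rightarrow> y i * t j))\<^sup>2) = (\<Sum>i<2. (cmod (y i))\<^sup>2) * (\<Sum>j<m. (cmod (t j))\<^sup>2)"
    unfolding sum_product sum.cartesian_product by (intro sum.cong refl) (auto simp: norm_mult power_mult_distrib)
  also have "(\<Sum>i<2. (cmod (y i))\<^sup>2) = 1" using x by (simp add: y_def numeral_2_eq_2 add.commute)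
  \<comment> \<open>The vector \<open>t\<close> lives on the first \<open>m\<close> coordinates,
    whereas the third marginal sums over all of factor 1.\<close>
  also have "(\<Sum>p\<in>{..<2} \<times> {..<m}. (cmod (C p))\<^sup>2) \<le> (\<Sum>p\<in>{..<2} \<times> {..<N}. (cmod (C p))\<^sup>2)"
    using m by (intro sum_mono2) auto
  also note C_le
  finally have "Z * Z \<le> Z * (\<nu> / c)" using t by (simp add: power2_eq_square)
  moreover have "Z > 0" unfolding Z using \<nu> m by simp
  ultimately have "Z \<le> \<nu> / c" by (rule mult_left_le_imp_le)
  then show False unfolding Z using \<nu> m by (simp add: field_simps)
qed

section \<open>The separating point in the polytope of the unit tensor\<close>


lemma invertible_mat_if_det_nonzero:
  fixes A :: "'a::field mat"
  assumes "A \<in> carrier_mat n n" "det A \<noteq> 0"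
  shows "invertible_mat A"
proof -
  obtain B where "B \<in> carrier_mat n n" "A * B = 1\<^sub>m n" "B * A = 1\<^sub>m n"
    using det_non_zero_imp_unit[OF assms, of "()"] unfolding Units_def ring_mat_def by auto
  then show ?thesis using assms(1) unfolding invertible_mat_def inverts_mat_def square_mat.simps by auto
qed

lemma finite_singular_shifts:
  assumes "A \<in> carrier_mat n n"
  shows "finite {e. det (char_matrix A e) = (0 :: complex)}"
proof -
  have "char_poly A \<noteq> 0" using degree_monic_char_poly[OF assms] by auto
  then have "finite {e. poly (char_poly A) e = 0}" by (rule poly_roots_finite)
  then show ?thesis
    using eigenvalue_det[OF assms] eigenvalue_root_char_poly[OF assms] by auto
qed

text \<open>Shifting a matrix by a small generic multiple of the identity makes it invertible.\<close>

lemma matrix_orbit_subset_closure_GL_orbit: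
  "matrix_orbit k N T \<subseteq> closure (GL_orbit (replicate k N) T)"
proof
  fix S assume "S \<in> matrix_orbit k N T"
  then obtain gs where gs: "length gs = k" "\<forall>l<k. gs ! l \<in> carrier_mat N N"
    "S = local_action (replicate k N) gs T" unfolding matrix_orbit_def by auto
  define hs where "hs e = map (\<lambda>G. char_matrix G e) gs" for e
  define f where "f e = local_action (replicate k N) (hs e) T" for e
  \<comment> \<open>The value 0 is removed because the matrices in \<open>gs\<close> may be
    singular; the limit uses only punctured neighbourhoods of 0.\<close>
  define F where "F = (\<Union>l<k. {e. det (char_matrix (gs ! l) e) = 0}) - {0}"
  have "finite F" unfolding F_def using gs finite_singular_shifts by (intro finite_Diff finite_UN_I) auto
  have f_eq: "f e js = (if js \<in> cube k N then \<Sum>is\<in>cube k N.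
      (\<Prod>l<k. (gs ! l) $$ (js ! l, is ! l) - e * of_bool (js ! l = is ! l)) * T is else 0)" for e js
  proof -
    have "hs e ! l $$ (i, j) = (gs ! l) $$ (i, j) - e * of_bool (i = j)" if "l < k" "i < N" "j < N" for l i j
      using that gs(1,2) by (auto simp: hs_def char_matrix_def)
    then show ?thesis unfolding f_def local_action_replicate
      by (auto simp: cube_def intro!: sum.cong prod.cong arg_cong2[where f = "(*)"])
  qed
  have "f 0 = S"
  proof
    fix js
    show "f 0 js = S js" unfolding f_eq gs(3) local_action_replicate by simp
  qed
  have "continuous_on UNIV f"
  proof (rule continuous_on_coordinatewise_then_product)
    fix js
    show "continuous_on UNIV (\<lambda>e. f e js)"
      unfolding f_eq by (cases "js \<in> cube k N") (auto intro!: continuous_intros)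
  qed
  then have "(f \<longlongrightarrow> f 0) (at 0)"
    using continuous_on_eq_continuous_at[of UNIV f] by (simp add: isCont_def)
  moreover have "eventually (\<lambda>e. f e \<in> closure (GL_orbit (replicate k N) T)) (at 0)"
    unfolding eventually_at_topological
  proof (intro exI[of _ "- F"] conjI ballI impI)
    show "open (- F)" using \<open>finite F\<close> by (simp add: finite_imp_closed open_Compl)
    show "0 \<in> - F" by (simp add: F_def)
    fix e assume "e \<in> - F" "e \<noteq> 0"
    then have "det (char_matrix (gs ! l) e) \<noteq> 0" if "l < k" for l using that unfolding F_def by auto
    then have "hs e \<in> GL_product (replicate k N)"
      using gs unfolding GL_product_def hs_def by (auto intro!: invertible_mat_if_det_nonzero[of _ N])
    then have "f e \<in> GL_orbit (replicate k N) T" unfolding f_def GL_orbit_def by blast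
    then show "f e \<in> closure (GL_orbit (replicate k N) T)" using closure_subset by blast
  qed
  ultimately have "f 0 \<in> closure (GL_orbit (replicate k N) T)"
    by (intro Lim_in_closed_set[of "closure (GL_orbit (replicate k N) T)" f "at 0"]) auto
  then show "S \<in> closure (GL_orbit (replicate k N) T)" unfolding \<open>f 0 = S\<close> .
qed

text \<open>The type \<open>tensor\<close> has room for values outside the index range. Their
  absence from the closure ensures that a nonzero element has positive norm.\<close>

lemma closure_GL_orbit_vanishes:
  assumes "S \<in> closure (GL_orbit (replicate k N) T)" "js \<notin> cube k N"
  shows "S js = 0"
proof -
  have "GL_orbit (replicate k N) T \<subseteq> {S. S js = 0}"
    using assms(2) by (auto simp: GL_orbit_def local_action_replicate)
  moreover have "closed {S :: tensor. S js = 0}"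
    by (intro closed_Collect_eq continuous_on_product_coordinates continuous_on_const)
  ultimately show ?thesis using assms(1) closure_minimal by blast
qed

text \<open>Orthogonality of the characters of Z/c, which performs the interpolation.\<close>

lemma sum_root_of_unity_powers:
  assumes "0 < c"
  shows "(\<Sum>s<c. cis (2 * pi / c) ^ (t * s)) = (if c dvd t then of_nat c else 0)"
proof -
  define z where "z = cis (2 * pi / c) ^ t"
  have z: "z = cis (2 * pi * t / c)" by (simp add: z_def DeMoivre mult_ac)
  have sum: "(\<Sum>s<c. cis (2 * pi / c) ^ (t * s)) = (\<Sum>s<c. z ^ s)"
    by (simp add: z_def power_mult)
  show ?thesis
  proof (cases "c dvd t")
    case True
    then obtain u where "t = c * u" by blast
    then have "2 * pi * t / c = 2 * pi * real u" using assms by simp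
    then have "z = cis (2 * pi * real u)" unfolding z by (simp only:)
    then have "z = 1" using cis_multiple_2pi[OF Ints_of_nat] by (simp only:)
    then show ?thesis using True by (simp add: sum)
  next
    case False
    have "z \<noteq> 1"
    proof
      assume "z = 1"
      then have "cos (2 * pi * t / c) = 1" by (metis cis.simps(1) one_complex.simps(1) z)
      then obtain u :: int where "2 * pi * t / c = of_int u * 2 * pi" by (auto simp: cos_one_2pi_int)
      then have "real t = of_int u * real c" using assms by (simp add: field_simps)
      then have "int t = u * int c" by (metis of_int_eq_iff of_int_mult of_int_of_nat_eq)
      then have "int c dvd int t" by simp
      then show False using False by (simp only: int_dvd_int_iff)
    qed
    moreover have "z ^ c = 1"
    proof -
      have "real c * (2 * pi * t / c) = 2 * pi * real t" using assms by simp
      then have "z ^ c = cis (2 * pi * real t)" unfolding z DeMoivre by (simp only:)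
      then show ?thesis using cis_multiple_2pi[OF Ints_of_nat] by (simp only:)
    qed
    ultimately show ?thesis using False by (simp add: sum geometric_sum)
  qed
qed

lemma local_action_unit_tensor:
  assumes "js \<in> cube k c"
  shows "local_action (replicate k c) gs (unit_tensor k c) js = (\<Sum>s<c. \<Prod>l<k. (gs ! l) $$ (js ! l, s))"
proof -
  have "local_action (replicate k c) gs (unit_tensor k c) js = (\<Sum>s<c. \<Prod>l<k. (gs ! l) $$ (js ! l, map (\<lambda>_. s) [0..<k] ! l))"
  proof (rule local_action_sum_basis)
    fix "is" :: "nat list"
    have "replicate k (unit_vec c s :: complex vec) = map (\<lambda>l. unit_vec c s) [0..<k]" for s
      by (simp add: map_replicate_const)
    then show "unit_tensor k c is = (\<Sum>s<c. if is = map (\<lambda>_. s) [0..<k] then 1 else 0)"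
      unfolding unit_tensor_def by (intro sum.cong refl) (simp only: tensor_product_unit_vecs lessThan_iff)
  qed (use assms in \<open>auto simp: cube_def\<close>)
  then show ?thesis by simp
qed

text \<open>
  The coefficients of the tensor of multiplication of a polynomial of degree at most \<open>1\<close> by one of
  degree less than \<open>m\<close>, rescaled so that all marginals are uniform.
\<close>

definition pencil_weight :: "nat \<Rightarrow> nat \<Rightarrow> nat \<Rightarrow> real" where
  "pencil_weight m i j = (if i = 0 then real (m - j) else real (j + 1))"

definition pencil_tensor :: "nat \<Rightarrow> nat \<Rightarrow> tensor" where
  "pencil_tensor k m js = (if js \<in> (\<lambda>(i, j). three_index k i j (i + j)) ` ({..<2} \<times> {..<m})
     then complex_of_real (sqrt (pencil_weight m (js ! 0) (js ! 1))) else 0)"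

text \<open>The weight splits into a function of \<open>j\<close> times a function of i + j.
  Diagonal rescalings of the second and third factors therefore produce it from coefficients 0 and
  1.\<close>

lemma pencil_weight_binomial:
  assumes "i < 2" "j < m"
  shows "pencil_weight m i j = real (m - j) * real (m choose j) / real (m choose (i + j))"
proof (cases "i = 0")
  case False
  then have "i = 1" using assms by simp
  have "Suc j * (m choose Suc j) = (m - j) * (m choose j)"
    by (metis binomial_absorb_comp binomial_absorption mult.commute)
  then have "real (Suc j) * real (m choose Suc j) = real (m - j) * real (m choose j)"
    by (metis of_nat_mult)
  moreover have "m choose Suc j > 0" using assms by simp
  ultimately show ?thesis using \<open>i = 1\<close> by (simp add: pencil_weight_def field_simps)
qed (use assms in \<open>simp add: pencil_weight_def\<close>)

lemma pencil_tensor_in_orbit: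
  assumes k: "3 \<le> k" and m: "1 \<le> m"
  shows "pencil_tensor k m \<in> matrix_orbit k (Suc m) (unit_tensor k (Suc m))"
proof -
  define c where "c = Suc m"
  have c0: "0 < c" "complex_of_nat c \<noteq> 0" unfolding c_def of_nat_eq_0_iff by simp_all
  define w where "w = cis (2 * pi / c)"
  define \<beta> where "\<beta> j = complex_of_real (sqrt (real (m - j) * real (m choose j)))" for j
  define \<delta> where "\<delta> l = complex_of_real (1 / sqrt (real (m choose l)))" for l
  \<comment> \<open>Column \<open>s\<close> belongs to the evaluation point w^s. The first two
    factors evaluate the monomial of degree \<open>a\<close>, the third extracts the coefficient of
    degree \<open>a\<close> by the inverse Fourier transform, with c - a in place of -a, and the
    others send every basis vector to the first one.\<close>
  define h where "h q a s = (if q = 0 then if a < 2 then w ^ (a * s) else 0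
    else if q = 1 then if a < m then \<beta> a * w ^ (a * s) else 0
    else if q = 2 then \<delta> a / of_nat c * w ^ ((c - a) * s) else if a = 0 then 1 else 0)" for q a s :: nat
  define gs where "gs = map (\<lambda>q. mat c c (\<lambda>(a, s). h q a s)) [0..<k]"
  have "local_action (replicate k c) gs (unit_tensor k c) = pencil_tensor k m"
  proof
    fix js
    show "local_action (replicate k c) gs (unit_tensor k c) js = pencil_tensor k m js"
    proof (cases "js \<in> cube k c")
      case False
      have "three_index k i j (i + j) \<in> cube k c" if "i < 2" "j < m" for i j
        using that k m by (intro three_index_in_cube) (auto simp: c_def)
      then have "js \<notin> (\<lambda>(i, j). three_index k i j (i + j)) ` ({..<2} \<times> {..<m})" using False by auto
      then show ?thesis using False by (simp add: pencil_tensor_def local_action_replicate)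
    next
      case True
      then have len: "length js = k" and bound: "\<And>q. q < k \<Longrightarrow> js ! q < c" by (auto simp: cube_def)
      have "local_action (replicate k c) gs (unit_tensor k c) js = (\<Sum>s<c. \<Prod>q<k. h q (js ! q) s)"
        unfolding local_action_unit_tensor[OF True]
        by (intro sum.cong prod.cong refl) (auto simp: gs_def bound)
      also have "\<dots> = pencil_tensor k m js"
      proof (cases "js ! 0 < 2 \<and> js ! 1 < m \<and> (\<forall>q. 3 \<le> q \<longrightarrow> q < k \<longrightarrow> js ! q = 0)")
        case False
        have "(\<Prod>q<k. h q (js ! q) s) = 0" for s
        proof -
          have "\<exists>q<k. h q (js ! q) s = 0"
          proof -
            consider "\<not> js ! 0 < 2" | "\<not> js ! 1 < m" | q where "3 \<le> q" "q < k" "js ! q \<noteq> 0" using False by blast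
            then show ?thesis
            proof cases
              case 1
              then show ?thesis using k by (intro exI[of _ 0]) (simp add: h_def)
            next
              case 2
              then show ?thesis using k by (intro exI[of _ 1]) (simp add: h_def)
            next
              case 3
              then show ?thesis by (intro exI[of _ q]) (simp add: h_def)
            qed
          qed
          then show ?thesis by (intro prod_zero) auto
        qed
        moreover have "js \<notin> (\<lambda>(i, j). three_index k i j (i + j)) ` ({..<2} \<times> {..<m})"
          using False k by (auto simp: nth_three_index)
        ultimately show ?thesis by (simp add: pencil_tensor_def)
      next
        case True
        define i j l where "i = js ! 0" and "j = js ! 1" and "l = js ! 2"
        have ij: "i < 2" "j < m" and rest: "\<And>q. 3 \<le> q \<Longrightarrow> q < k \<Longrightarrow> js ! q = 0"
          using True unfolding i_def j_def by blast+
        have l: "l < c" unfolding l_def using bound k by simp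
        have js: "js = three_index k i j l"
          unfolding i_def j_def l_def by (rule eq_three_indexI[OF k len rest])
        have "(\<Prod>q<k. h q (js ! q) s) = \<beta> j * \<delta> l / of_nat c * w ^ ((i + j + (c - l)) * s)" for s
        proof -
          have "{..<k} = insert 0 (insert 1 (insert 2 {3..<k}))" using k by auto
          moreover have "(\<Prod>q\<in>{3..<k}. h q (js ! q) s) = 1" using rest by (intro prod.neutral) (auto simp: h_def)
          ultimately have "(\<Prod>q<k. h q (js ! q) s) = h 0 i s * h 1 j s * h 2 l s"
            by (simp add: i_def j_def l_def mult.assoc)
          also have "\<dots> = \<beta> j * \<delta> l / of_nat c * w ^ ((i + j + (c - l)) * s)"
            unfolding add_mult_distrib power_add using ij by (simp add: h_def)
          finally show ?thesis .
        qed
        then have "(\<Sum>s<c. \<Prod>q<k. h q (js ! q) s) = \<beta> j * \<delta> l / of_nat c * (\<Sum>s<c. w ^ ((i + j + (c - l)) * s))"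
          by (simp add: sum_distrib_left)
        also have "\<dots> = \<beta> j * \<delta> l * (if c dvd i + j + (c - l) then 1 else 0)"
          unfolding w_def using c0 by (subst sum_root_of_unity_powers) auto
        \<comment> \<open>Degrees of products stay below \<open>c\<close>, so this sum lies strictly
          between 0 and 2 c, and the only multiple of \<open>c\<close> it can equal is
          \<open>c\<close> itself.\<close>
        also have "c dvd i + j + (c - l) \<longleftrightarrow> l = i + j"
        proof
          assume "c dvd i + j + (c - l)"
          then obtain u where u: "i + j + (c - l) = c * u" by blast
          have "0 < i + j + (c - l)" "i + j + (c - l) < c * 2" using l ij by (auto simp: c_def)
          then have "0 < c * u" "c * u < c * 2" unfolding u .
          then have "0 < u" "u < 2" by simp_all
          then have "u = 1" by simp
          then show "l = i + j" using u l by simp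
        qed (use l in simp)
        also have "\<beta> j * \<delta> l * (if l = i + j then 1 else 0) = pencil_tensor k m js"
        proof (cases "l = i + j")
          case True
          have "js \<in> (\<lambda>(i, j). three_index k i j (i + j)) ` ({..<2} \<times> {..<m})"
            using ij by (intro image_eqI[of _ _ "(i, j)"]) (auto simp: js True)
          then have "pencil_tensor k m js = complex_of_real (sqrt (pencil_weight m i j))"
            by (simp add: pencil_tensor_def i_def j_def)
          then show ?thesis unfolding pencil_weight_binomial[OF ij]
            by (simp add: True \<beta>_def \<delta>_def real_sqrt_mult real_sqrt_divide)
        next
          case False
          have "js \<notin> (\<lambda>(i, j). three_index k i j (i + j)) ` ({..<2} \<times> {..<m})"
            using False by (auto simp: js three_index_def)
          then show ?thesis using False by (simp add: pencil_tensor_def)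
        qed
        finally show ?thesis .
      qed
      finally show ?thesis .
    qed
  qed
  moreover have "length gs = k" "\<forall>l<k. gs ! l \<in> carrier_mat c c" by (auto simp: gs_def)
  ultimately show ?thesis unfolding matrix_orbit_def c_def[symmetric]
    by (intro CollectI exI[of _ gs] conjI) (simp_all only:)
qed

section \<open>Marginals of the tensor of polynomial multiplication\<close>

lemma gram_diagonal:
  assumes "q < k" "a < N"
  shows "gram k N q S a a = complex_of_real (\<Sum>js\<in>{js \<in> cube k N. js ! q = a}. (cmod (S js))\<^sup>2)"
proof -
  have "gram k N q S a a = complex_of_real (\<Sum>js\<in>{js \<in> cube k N. js ! q = 0}. (cmod (S (js[q := a])))\<^sup>2)"
    unfolding gram_def of_real_sum complex_norm_square by (intro sum.cong refl mult.commute)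
  also have "(\<Sum>js\<in>{js \<in> cube k N. js ! q = 0}. (cmod (S (js[q := a])))\<^sup>2) = (\<Sum>js\<in>{js \<in> cube k N. js ! q = a}. (cmod (S js))\<^sup>2)"
  proof (rule sum.reindex_bij_witness[where j = "\<lambda>js. js[q := a]" and i = "\<lambda>js. js[q := 0]"])
    fix js assume js: "js \<in> {js \<in> cube k N. js ! q = 0}"
    then show "js[q := a, q := 0] = js" by (simp, metis list_update_id)
    show "js[q := a] \<in> {js \<in> cube k N. js ! q = a}" using js assms cube_update[of js k N a q] by (auto simp: cube_def)
  next
    fix js assume js: "js \<in> {js \<in> cube k N. js ! q = a}"
    then show "js[q := 0, q := a] = js" by (simp, metis list_update_id)
    show "js[q := 0] \<in> {js \<in> cube k N. js ! q = 0}" using js assms cube_update[of js k N 0 q] by (auto simp: cube_def)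
  qed simp
  finally show ?thesis .
qed

text \<open>Defined for every \<open>a\<close>, with value 0 past the support, so that padding a
  component amounts to a longer range of \<open>a\<close>.\<close>

definition separating_point :: "nat \<Rightarrow> nat \<Rightarrow> nat \<Rightarrow> real" where
  "separating_point m q a = (if q = 0 then if a < 2 then 1 / 2 else 0
     else if q = 1 then if a < m then 1 / real m else 0
     else if q = 2 then if a < Suc m then 1 / real (Suc m) else 0
     else if a = 0 then 1 else 0)"

text \<open>Any two of i, j, i + j determine the third, so distinct slices have disjoint supports
  and the marginals are diagonal. The weights m - j and j + 1 add up to m (m + 1) / 2 for fixed i,
  to m + 1 for fixed j, and to (m - a) + a = m for fixed i + j = a; the total is m (m + 1).\<close>

lemma gram_pencil_tensor:
  assumes k: "3 \<le> k" and m: "1 \<le> m" and q: "q < k" and ab: "a < Suc m" "b < Suc m"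
  shows "gram k (Suc m) q (pencil_tensor k m) a b =
    (if a = b then complex_of_real (real (m * (m + 1)) * separating_point m q a) else 0)"
proof -
  let ?e = "\<lambda>(i, j). three_index k i j (i + j)" and ?I = "{..<2} \<times> {..<m}"
  have e_cube: "?e p \<in> cube k (Suc m)" if "p \<in> ?I" for p
    using that k m by (auto intro!: three_index_in_cube)
  show ?thesis
  proof (cases "a = b")
    case False
    have "cnj (pencil_tensor k m (js[q := a])) * pencil_tensor k m (js[q := b]) = 0"
      if js: "js \<in> {js \<in> cube k (Suc m). js ! q = 0}" for js
    proof (rule ccontr)
      assume "\<not> ?thesis"
      then have "js[q := a] \<in> ?e ` ?I" "js[q := b] \<in> ?e ` ?I"
        unfolding pencil_tensor_def by (auto split: if_splits)
      then obtain i j i' j' where e: "js[q := a] = three_index k i j (i + j)" "js[q := b] = three_index k i' j' (i' + j')"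
        by auto
      have len: "length js = k" using js by (simp add: cube_def)
      have n: "(if p = q then a else js ! p) = (if p = 0 then i else if p = 1 then j else if p = 2 then i + j else 0)"
        "(if p = q then b else js ! p) = (if p = 0 then i' else if p = 1 then j' else if p = 2 then i' + j' else 0)"
        if "p < k" for p
      proof -
        have "(if p = q then x else js ! p) = js[q := x] ! p" for x
          using that len by (simp add: nth_list_update)
        then show "(if p = q then a else js ! p) = (if p = 0 then i else if p = 1 then j else if p = 2 then i + j else 0)"
          "(if p = q then b else js ! p) = (if p = 0 then i' else if p = 1 then j' else if p = 2 then i' + j' else 0)"
          by (simp_all only: e nth_three_index[OF k that])
      qed
      show False
        using n[of 0] n[of 1] n[of 2] n[of q] q k False by (auto split: if_splits)
    qed
    then show ?thesis using False unfolding gram_def by (simp add: sum.neutral)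
  next
    case True
    have inj: "inj_on ?e ?I" by (auto simp: inj_on_def three_index_def)
    have "(\<Sum>js\<in>{js \<in> cube k (Suc m). js ! q = a}. (cmod (pencil_tensor k m js))\<^sup>2) =
        (\<Sum>js\<in>cube k (Suc m). if js ! q = a then (cmod (pencil_tensor k m js))\<^sup>2 else 0)"
      by (simp add: sum.If_cases Int_def conj_commute)
    also have "\<dots> = (\<Sum>js\<in>?e ` ?I. if js ! q = a then (cmod (pencil_tensor k m js))\<^sup>2 else 0)"
      by (rule sum.mono_neutral_right) (use e_cube in \<open>auto simp: pencil_tensor_def\<close>)
    also have "\<dots> = (\<Sum>p\<in>?I. if ?e p ! q = a then (cmod (pencil_tensor k m (?e p)))\<^sup>2 else 0)"
      by (simp add: sum.reindex[OF inj])
    also have "\<dots> = (\<Sum>(i, j)\<in>?I. if three_index k i j (i + j) ! q = a then pencil_weight m i j else 0)"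
    proof (intro sum.cong refl)
      fix p :: "nat \<times> nat" assume p: "p \<in> ?I"
      obtain i j where ij: "p = (i, j)" by fastforce
      have "?e p \<in> ?e ` ?I" using p by blast
      moreover have "?e p ! 0 = i" "?e p ! 1 = j" using k by (simp_all add: ij nth_three_index)
      ultimately have "pencil_tensor k m (?e p) = complex_of_real (sqrt (pencil_weight m i j))"
        unfolding pencil_tensor_def by (simp only: if_True)
      then have "(cmod (pencil_tensor k m (?e p)))\<^sup>2 = pencil_weight m i j"
        by (simp add: pencil_weight_def)
      then show "(if ?e p ! q = a then (cmod (pencil_tensor k m (?e p)))\<^sup>2 else 0) =
         (case p of (i, j) \<Rightarrow> if three_index k i j (i + j) ! q = a then pencil_weight m i j else 0)"
        by (simp add: ij)
    qed
    also have "\<dots> = (\<Sum>i<2. \<Sum>j<m. if three_index k i j (i + j) ! q = a then pencil_weight m i j else 0)"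
      by (rule sum.cartesian_product[symmetric])
    also have "\<dots> = (\<Sum>j<m. if three_index k 0 j j ! q = a then real m - real j else 0) +
        (\<Sum>j<m. if three_index k 1 j (Suc j) ! q = a then real j + 1 else 0)"
      by (auto simp: numeral_2_eq_2 pencil_weight_def intro!: sum.cong arg_cong2[where f = "(+)"])
    also have "\<dots> = real (m * (m + 1)) * separating_point m q a"
    proof -
      have sum1: "(\<Sum>j<m. real j + 1) = real m * (real m + 1) / 2"
        by (induction m) (simp_all add: field_simps)
      have "(\<Sum>j<m. real m - real j) + (\<Sum>j<m. real j + 1) = (\<Sum>j<m. real m + 1)"
        unfolding sum.distrib[symmetric] by (intro sum.cong) auto
      then have sum0: "(\<Sum>j<m. real m - real j) = real m * (real m + 1) / 2"
        unfolding sum1 by (simp add: field_simps)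
      consider "q = 0" | "q = 1" | "q = 2" | "3 \<le> q" by linarith
      then show ?thesis
      proof cases
        case 1
        have idx: "three_index k 0 j j ! q = 0" "three_index k 1 j (Suc j) ! q = 1" for j
          using nth_three_index[OF k q] 1 by simp_all
        have "(\<Sum>j<m. if 0 = a then real m - real j else 0) = (if a = 0 then real m * (real m + 1) / 2 else 0)"
          using sum0 by simp
        moreover have "(\<Sum>j<m. if 1 = a then real j + 1 else 0) = (if a = 1 then real m * (real m + 1) / 2 else 0)"
          using sum1 by simp
        ultimately show ?thesis unfolding idx by (simp add: 1 separating_point_def field_simps)
      next
        case 2
        then show ?thesis using k q m ab
          by (auto simp: nth_three_index separating_point_def field_simps)
      next
        case 3
        \<comment> \<open>At \<open>a = m\<close> no \<open>j\<close> matches, and the missing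
          weight is m - m = 0; likewise nothing is lost at \<open>a = 0\<close> in the second
          sum.\<close>
        have "(\<Sum>j<m. if j = a then real m - real j else 0) = real m - real a"
          using ab by (cases "a = m") auto
        moreover have "(\<Sum>j<m. if Suc j = a then real j + 1 else 0) = real a"
          using ab by (cases a) auto
        ultimately show ?thesis using k q 3 ab
          by (simp add: nth_three_index separating_point_def field_simps)
      next
        case 4
        have idx: "three_index k i j l ! q = 0" for i j l
          using nth_three_index[OF k q] 4 by simp
        have "(\<Sum>j<m. if 0 = a then real m - real j else 0) = (if a = 0 then real m * (real m + 1) / 2 else 0)"
          using sum0 by simp
        moreover have "(\<Sum>j<m. if 0 = a then real j + 1 else 0) = (if a = 0 then real m * (real m + 1) / 2 else 0)"
          using sum1 by simp
        ultimately show ?thesis unfolding idx using 4 by (simp add: separating_point_def field_simps)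
      qed
    qed
    finally show ?thesis unfolding True[symmetric] gram_diagonal[OF q ab(1)] by simp
  qed
qed

lemma sqnorm_pencil_tensor:
  assumes "3 \<le> k" "1 \<le> m"
  shows "sqnorm k (Suc m) (pencil_tensor k m) = real (m * (m + 1))"
proof -
  have "(\<Sum>a<Suc m. separating_point m 0 a) = (\<Sum>a<2. separating_point m 0 a)"
    by (rule sum.mono_neutral_right) (use assms in \<open>auto simp: separating_point_def\<close>)
  also have "\<dots> = 1" by (simp add: separating_point_def numeral_2_eq_2)
  finally have one: "(\<Sum>a<Suc m. separating_point m 0 a) = 1" .
  have "complex_of_real (sqnorm k (Suc m) (pencil_tensor k m)) = (\<Sum>a<Suc m. gram k (Suc m) 0 (pencil_tensor k m) a a)"
    using assms by (intro sqnorm_eq_sum_gram) simp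
  also have "\<dots> = (\<Sum>a<Suc m. complex_of_real (real (m * (m + 1)) * separating_point m 0 a))"
    using assms by (intro sum.cong refl) (simp add: gram_pencil_tensor)
  also have "\<dots> = complex_of_real (real (m * (m + 1)) * (\<Sum>a<Suc m. separating_point m 0 a))"
    unfolding sum_distrib_left of_real_sum ..
  finally show ?thesis unfolding one by (simp only: of_real_eq_iff mult_1_right)
qed

lemma spec_pencil_tensor:
  assumes k: "3 \<le> k" and m: "1 \<le> m" and q: "q < k"
  shows "spec (moment_component (replicate k (Suc m)) q (pencil_tensor k m)) = map (separating_point m q) [0..<Suc m]"
proof -
  have "real (m * (m + 1)) \<noteq> 0" using m by (simp del: of_nat_mult of_nat_add)
  then have "moment_component (replicate k (Suc m)) q (pencil_tensor k m) =
      mat (Suc m) (Suc m) (\<lambda>(i, j). if i = j then complex_of_real (map (separating_point m q) [0..<Suc m] ! i) else 0)"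
    using moment_component_carrier[OF q, of "Suc m" "pencil_tensor k m"]
    by (intro eq_matI) (auto simp: moment_component_index[OF q] gram_pencil_tensor[OF k m q] sqnorm_pencil_tensor[OF k m]
        simp del: upt_Suc of_nat_mult of_nat_add)
  moreover have "sorted_wrt (\<ge>) (map (separating_point m q) [0..<Suc m])"
    unfolding sorted_wrt_iff_nth_less by (auto simp: separating_point_def simp del: upt_Suc)
  ultimately show ?thesis by (simp only: spec_diagonal[of _ "Suc m"] length_map length_upt diff_zero)
qed

section \<open>The separating point and the two polytopes\<close>

lemma separating_point_in_unit_tensor_polytope:
  assumes k: "3 \<le> k" and m: "1 \<le> m"
  shows "map (\<lambda>q. map (separating_point m q) [0..<Suc m]) [0..<k] \<in>
    moment_polytope (replicate k (Suc m)) (unit_tensor k (Suc m))"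
proof -
  have "pencil_tensor k m \<in> closure (GL_orbit (replicate k (Suc m)) (unit_tensor k (Suc m)))"
    using pencil_tensor_in_orbit[OF k m] matrix_orbit_subset_closure_GL_orbit by blast
  moreover have "pencil_tensor k m \<noteq> (\<lambda>_. 0)"
  proof
    assume "pencil_tensor k m = (\<lambda>_. 0)"
    then have "sqnorm k (Suc m) (pencil_tensor k m) = 0" by (simp add: sqnorm_def)
    then show False using sqnorm_pencil_tensor[OF k m] m by (simp del: of_nat_mult of_nat_add)
  qed
  moreover have "spec_moment (replicate k (Suc m)) (pencil_tensor k m) = map (\<lambda>q. map (separating_point m q) [0..<Suc m]) [0..<k]"
    unfolding spec_moment_def length_replicate by (intro map_cong refl) (simp add: spec_pencil_tensor[OF k m] del: upt_Suc)
  ultimately show ?thesis unfolding moment_polytope_def by (intro image_eqI[where x = "pencil_tensor k m"]) auto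
qed

lemma separating_point_notin_matmul_polytope:
  assumes k: "3 \<le> k" and n: "2 \<le> n" and m: "(n - 1) * n < m" "m < n\<^sup>2"
  shows "map (\<lambda>q. map (separating_point m q) [0..<n\<^sup>2]) [0..<k] \<notin>
    moment_polytope (replicate k (n\<^sup>2)) (iterated_matmul_tensor k n)"
proof
  let ?N = "n\<^sup>2" and ?M = "iterated_matmul_tensor k n"
  assume "map (\<lambda>q. map (separating_point m q) [0..<?N]) [0..<k] \<in> moment_polytope (replicate k ?N) ?M"
  then obtain S where "map (\<lambda>q. map (separating_point m q) [0..<?N]) [0..<k] = spec_moment (replicate k ?N) S"
    "S \<in> closure (GL_orbit (replicate k ?N) ?M) - {\<lambda>_. 0}"
    unfolding moment_polytope_def by (rule imageE)
  then have S: "S \<in> closure (GL_orbit (replicate k ?N) ?M)" "S \<noteq> (\<lambda>_. 0)"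
    "spec_moment (replicate k ?N) S = map (\<lambda>q. map (separating_point m q) [0..<?N]) [0..<k]"
    by (simp_all only: Diff_iff singleton_iff simp_thms)
  have spec: "spec (moment_component (replicate k ?N) q S) = map (separating_point m q) [0..<?N]" if "q < k" for q
    using arg_cong[OF S(3), of "\<lambda>xs. xs ! q"] that by (simp add: spec_moment_def)
  obtain js where js: "js \<in> cube k ?N" "S js \<noteq> 0"
    using S(2) closure_GL_orbit_vanishes[OF S(1)] by blast
  then have pos: "sqnorm k ?N S > 0" unfolding sqnorm_def by (intro sum_pos2[of _ js]) auto
  have "S \<in> closure (matrix_orbit k ?N ?M)"
    using S(1) closure_mono[OF GL_orbit_subset_matrix_orbit] by blast
  then obtain R where R: "R \<in> closure (matrix_orbit k ?N ?M)"
    "\<And>q a b. q < k \<Longrightarrow> a < ?N \<Longrightarrow> b < ?N \<Longrightarrow> gram k ?N q R a b =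
       (if a = b then complex_of_real (sqnorm k ?N S * spec (moment_component (replicate k ?N) q S) ! a) else 0)"
    using diagonal_representative[OF _ pos] by metis
  have G: "gram k ?N q R a b = (if a = b then complex_of_real (sqnorm k ?N S * separating_point m q a) else 0)"
    if "q < k" "a < ?N" "b < ?N" for q a b
    using R(2)[OF that] spec[OF that(1)] that by simp
  have "2 \<le> ?N" using m n by (cases "m = 0") auto
  have "\<not> has_singular_slice k ?N m R"
  \<comment> \<open>The marginals in \<open>gram\<close> are not normalized, so the squared norm of
    \<open>S\<close> takes the place of 1.\<close>
  proof (rule uniform_marginals_no_singular_slice[where \<nu> = "sqnorm k ?N S" and c = "Suc m"
        and d = "\<lambda>a. sqnorm k ?N S * separating_point m 2 a"])
    show "sqnorm k ?N S * separating_point m 2 a \<le> sqnorm k ?N S / real (Suc m)" for a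
      using pos by (auto simp: separating_point_def)
  qed (use k m pos \<open>2 \<le> ?N\<close> in \<open>auto simp: G separating_point_def\<close>)
  moreover have "has_singular_slice k ?N m R"
    using closure_matmul_has_singular_slice[OF k n m(1) _ R(1)] m(2) by simp
  ultimately show False by blast
qed

theorem theorem1p6:
  fixes k n c :: nat
  assumes "k \<ge> 3" and "n > 0" and "c > 0"
    and "n\<^sup>2 - n + 1 < c" and "c \<le> n\<^sup>2"
  shows "\<not> pad_components (n\<^sup>2) ` moment_polytope (replicate k c) (unit_tensor k c)
           \<subseteq> moment_polytope (replicate k (n\<^sup>2)) (iterated_matmul_tensor k n)"
proof
  assume sub: "pad_components (n\<^sup>2) ` moment_polytope (replicate k c) (unit_tensor k c)
           \<subseteq> moment_polytope (replicate k (n\<^sup>2)) (iterated_matmul_tensor k n)"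
  define m where "m = c - 1"
  have c: "c = Suc m" using assms(3) by (simp add: m_def)
  have n: "2 \<le> n"
  proof (rule ccontr)
    assume "\<not> 2 \<le> n"
    then have "n = 1" using assms(2) by simp
    then show False using assms(4,5) by simp
  qed
  \<comment> \<open>With c = m + 1 the lower bound on \<open>c\<close> is exactly (n - 1) n < m, and
    the upper bound leaves room for a uniform vector of length m + 1.\<close>
  have "(n - 1) * n = n\<^sup>2 - n" by (simp add: power2_eq_square diff_mult_distrib)
  then have m: "(n - 1) * n < m" "m < n\<^sup>2" using assms(4,5) c by auto
  let ?p = "map (\<lambda>q. map (separating_point m q) [0..<Suc m]) [0..<k]"
  have "?p \<in> moment_polytope (replicate k c) (unit_tensor k c)"
    unfolding c using assms(1) m(1) by (intro separating_point_in_unit_tensor_polytope) auto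
  moreover have "pad_components (n\<^sup>2) ?p = map (\<lambda>q. map (separating_point m q) [0..<n\<^sup>2]) [0..<k]"
  proof -
    \<comment> \<open>No component has support longer than m + 1, so appending zeros agrees with
      evaluating on the longer range.\<close>
    have "map (separating_point m q) [0..<Suc m] @ replicate (n\<^sup>2 - Suc m) 0 = map (separating_point m q) [0..<n\<^sup>2]" for q
      using m n by (intro nth_equalityI) (auto simp: nth_append separating_point_def simp del: upt_Suc)
    then show ?thesis by (simp add: pad_components_def del: upt_Suc)
  qed
  ultimately show False
    using sub separating_point_notin_matmul_polytope[OF assms(1) n m] by (metis image_eqI subsetD)
qed

end
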